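(* Let $d, p, q \in \mathbb{N}^+$ be fixed, let $\Theta$ be a compact subset of $\mathbb{R}^q$, and for each $\boldsymbol{\theta}\in\Theta$ let $\{c_{\boldsymbol{\theta} k\ell}(\mathbf{h})\}_{1\le k,\ell\le p}$, $\mathbf{h}\in\mathbb{R}^d$, be the matrix covariance function of a zero-mean real-valued $p$-variate stationary random process on $\mathbb{R}^d$. Assume: (1) There exist finite constants $A>0$ and $\tau>0$, independent of $\boldsymbol{\theta}$, such that for all $\boldsymbol{\theta}\in\Theta$, all $1\le k,\ell\le p$ and all $\mathbf{x}\in\mathbb{R}^d$, $$|c_{\boldsymbol{\theta}k\ell}(\mathbf{x})| \le \frac{A}{1+|\mathbf{x}|^{d+\tau}}.$$ (2) For all $\boldsymbol{\theta}\in\Theta$, all $1\le k,\ell\le p$ and all $\mathbf{x}\in\mathbb{R}^d$, $$c_{\boldsymbol{\theta}k\ell}(\mathbf{x}) = \int_{\mathbb{R}^d} \hat{c}_{\boldsymbol{\theta}k\ell}(\mathbf{f})\, e^{\imath \mathbf{f}\cdot\mathbf{x}}\, d\mathbf{f}.$$ (3) The Hermitian matrix $\hat{\mathbf{C}}_{\boldsymbol{\theta}}(\mathbf{f}) = \{\hat{c}_{\boldsymbol{\theta}k\ell}(\mathbf{f})\}_{1\le k,\ell\le p}$ is jointly continuous in $\mathbf{f}\in\mathbb{R}^d$ and $\boldsymbol{\theta}\in\Theta$, and $\lambda_1\{\hat{\mathbf{C}}_{\boldsymbol{\theta}}(\mathbf{f})\}>0$ for all $\mathbf{f}\in\mathbb{R}^d$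 and $\boldsymbol{\theta}\in\Theta$. (4) $(\mathbf{x}^{(1)}_i)_{i\in\mathbb{N}^+},\dots,(\mathbf{x}^{(p)}_i)_{i\in\mathbb{N}^+}$ are $p$ sequences of points in $\mathbb{R}^d$ for which there exists a fixed $\Delta>0$ such that for all $1\le k\le p$, $\inf_{i,j\in\mathbb{N}^+;\, i\ne j} |\mathbf{x}^{(k)}_i-\mathbf{x}^{(k)}_j| \ge \Delta$. For $n_1,\dots,n_p\in\mathbb{N}^+$, let $N_0=0$, $N_k = n_1+\dots+n_k$ for $1\le k\le p$, $N=N_p$, and for $\boldsymbol{\theta}\in\Theta$ let $\boldsymbol{\Sigma}_{\boldsymbol{\theta}}$ (depending also on $n_1,\dots,n_p$) be the $N\times N$ matrix whose $(a,b)$ entry is $c_{\boldsymbol{\theta}k\ell}(\mathbf{x}^{(k)}_i-\mathbf{x}^{(\ell)}_j)$ for $a=N_{k-1}+i$, $b=N_{\ell-1}+j$, $1\le k,\ell\le p$, $1\le i\le n_k$, $1\le j\le n_\ell$. Then $$\inf_{\boldsymbol{\theta}\in\Theta,\; n_1,\dots,n_p\in\mathbb{N}^+} \lambda_1(\boldsymbol{\Sigma}_{\boldsymbol{\theta}}) > 0.$$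
   Context: For a vector $\mathbf{x}\in\mathbb{C}^m$ (in particular $\mathbf{x}\in\mathbb{R}^m$), $|\mathbf{x}| = \max_{1\le i\le m}|x_i|$. For a Hermitian $m\times m$ matrix $\mathbf{M}$, $\lambda_1(\mathbf{M})\le\dots\le\lambda_m(\mathbf{M})$ denote its (real) eigenvalues, so $\lambda_1$ is the smallest eigenvalue. $\imath^2=-1$. The Fourier transform of $g:\mathbb{R}^d\to\mathbb{R}$ is $\hat g(\mathbf{f}) = (2\pi)^{-d}\int_{\mathbb{R}^d} g(\mathbf{x}) e^{-\imath\mathbf{f}\cdot\mathbf{x}}\,d\mathbf{x}$. The matrix covariance function $\{c_{k\ell}\}$ of a zero-mean stationary process $\{Z_k(\mathbf{s}): \mathbf{s}\in\mathbb{R}^d, 1\le k\le p\}$ is given by $c_{k\ell}(\mathbf{s}-\mathbf{t}) = \mathrm{Cov}(Z_k(\mathbf{s}),Z_\ell(\mathbf{t}))$, assumed to depend only on $\mathbf{s}-\mathbf{t}$. In particular the $c_{\boldsymbol{\theta}k\ell}$ are real-valued, $c_{\boldsymbol{\theta}k\ell}(-\mathbf{h})=c_{\boldsymbol{\theta}\ell k}(\mathbf{h})$, and $\boldsymbol{\Sigma}_{\boldsymbol{\theta}}$ is real symmetric. Under the decay condition (1), each $\hat c_{\boldsymbol{\theta}k\ell}$ is well defined, continuous and bounded in $\mathbf{f}$, and $\hat{\mathbf{C}}_{\boldsymbol{\theta}}(\mathbf{f})$ is Hermitian for every $\mathbf{f}$. Points of different sequences (different $k$) are allowed to coincide. *)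

theory Defs
  imports "HOL-Probability.Probability" "Jordan_Normal_Form.Char_Poly"
begin

definition fourier :: "(real ^ 'd \<Rightarrow> real) \<Rightarrow> real ^ 'd \<Rightarrow> complex" where
  "fourier g f = of_real (1 / (2 * pi) ^ CARD('d)) *
     (LINT x|lborel. of_real (g x) * exp (- \<i> * of_real (inner f x)))"

definition covariance :: "'a measure \<Rightarrow> ('a \<Rightarrow> real) \<Rightarrow> ('a \<Rightarrow> real) \<Rightarrow> real" where
  "covariance M X Y =
     (LINT w|M. (X w - (LINT v|M. X v)) * (Y w - (LINT v|M. Y v)))"

text \<open>Stationarity is second-order stationarity: the covariance of \<open>Z k s\<close> and \<open>Z l t\<close>
  exists and depends on \<open>s - t\<close> only. Components are numbered from 1 to \<open>p\<close>.\<close>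

definition matrix_covariance_function ::
  "nat \<Rightarrow> 'a measure \<Rightarrow> (nat \<Rightarrow> real ^ 'd \<Rightarrow> 'a \<Rightarrow> real) \<Rightarrow> (nat \<Rightarrow> nat \<Rightarrow> real ^ 'd \<Rightarrow> real) \<Rightarrow> bool" where
  "matrix_covariance_function p M Z c \<longleftrightarrow>
     prob_space M \<and>
     (\<forall>k\<in>{1..p}. \<forall>s. Z k s \<in> borel_measurable M \<and>
        integrable M (\<lambda>w. (Z k s w)\<^sup>2) \<and> (LINT w|M. Z k s w) = 0) \<and>
     (\<forall>k\<in>{1..p}. \<forall>l\<in>{1..p}. \<forall>s t. covariance M (Z k s) (Z l t) = c k l (s - t))"

text \<open>Intended for Hermitian matrices of positive dimension, all of whose eigenvalues are real.\<close>

definition lambda_1 :: "complex mat \<Rightarrow> real" where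
  "lambda_1 A = Min {x. eigenvalue A (of_real x)}"

definition spectral_matrix ::
  "nat \<Rightarrow> (nat \<Rightarrow> nat \<Rightarrow> real ^ 'd \<Rightarrow> real) \<Rightarrow> real ^ 'd \<Rightarrow> complex mat" where
  "spectral_matrix p c f = Matrix.mat p p (\<lambda>(k, l). fourier (c (Suc k) (Suc l)) f)"

definition block_end :: "(nat \<Rightarrow> nat) \<Rightarrow> nat \<Rightarrow> nat" where
  "block_end n k = (\<Sum>j=1..k. n j)"

text \<open>For \<open>n k > 0\<close>, every \<open>a \<ge> 1\<close> up to \<open>block_end n p\<close> is uniquely of the form
  \<open>block_end n (k - 1) + i\<close> with \<open>1 \<le> k \<le> p\<close> and \<open>1 \<le> i \<le> n k\<close>; the next two functions
  recover \<open>k\<close> and \<open>i\<close>.\<close>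

definition block_of :: "(nat \<Rightarrow> nat) \<Rightarrow> nat \<Rightarrow> nat" where
  "block_of n a = (LEAST k. a \<le> block_end n k)"

definition pos_of :: "(nat \<Rightarrow> nat) \<Rightarrow> nat \<Rightarrow> nat" where
  "pos_of n a = a - block_end n (block_of n a - 1)"

text \<open>Matrix indices start at 0, so row \<open>a\<close> below is row \<open>a + 1\<close> in the usual numbering.\<close>

definition covariance_matrix ::
  "nat \<Rightarrow> (nat \<Rightarrow> nat \<Rightarrow> real ^ 'd \<Rightarrow> real) \<Rightarrow> (nat \<Rightarrow> nat \<Rightarrow> real ^ 'd) \<Rightarrow> (nat \<Rightarrow> nat) \<Rightarrow> real mat" where
  "covariance_matrix p c x n = Matrix.mat (block_end n p) (block_end n p)
     (\<lambda>(a, b). c (block_of n (Suc a)) (block_of n (Suc b))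
        (x (block_of n (Suc a)) (pos_of n (Suc a)) - x (block_of n (Suc b)) (pos_of n (Suc b))))"

lemma block_end_mono: "k \<le> l \<Longrightarrow> block_end n k \<le> block_end n l"
  unfolding block_end_def by (rule sum_mono2) auto

lemma block_end_Suc: "1 \<le> k \<Longrightarrow> block_end n k = block_end n (k - 1) + n k"
  unfolding block_end_def by (cases k) auto

lemma block_of_eq:
  assumes "1 \<le> k" "1 \<le> i" "i \<le> n k"
  shows "block_of n (block_end n (k - 1) + i) = k"
  unfolding block_of_def
proof (rule Least_equality)
  show "block_end n (k - 1) + i \<le> block_end n k"
    using assms block_end_Suc[of k n] by simp
  fix y assume y: "block_end n (k - 1) + i \<le> block_end n y"
  show "k \<le> y"
  proof (rule ccontr)
    assume "\<not> k \<le> y"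
    then have "block_end n y \<le> block_end n (k - 1)" by (intro block_end_mono) simp
    with y assms show False by simp
  qed
qed

lemma covariance_matrix_entry:
  assumes "k \<in> {1..p}" "l \<in> {1..p}" "i \<in> {1..n k}" "j \<in> {1..n l}"
  shows "covariance_matrix p c x n $$ (block_end n (k - 1) + i - 1, block_end n (l - 1) + j - 1)
           = c k l (x k i - x l j)"
proof -
  have bound: "block_end n (m - 1) + r \<le> block_end n p"
    if "m \<in> {1..p}" "r \<in> {1..n m}" for m r
    using that block_end_Suc[of m n] block_end_mono[of m p n] by simp
  show ?thesis
    using assms bound[of k i] bound[of l j] block_of_eq[of k i n] block_of_eq[of l j n]
    by (cases i; cases j) (simp_all add: covariance_matrix_def pos_of_def)
qed

end

theory Submission
  imports Defs "Jordan_Normal_Form.Spectral_Radius"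
begin

text \<open>By Fourier inversion the quadratic form of the covariance matrix at \<open>v\<close> is
  \<open>\<integral> U(f)\<^sup>* C(f) U(f) df\<close>, where \<open>C\<close> is the spectral matrix and
  \<open>U\<^sub>k(f) = \<Sum>\<^sub>i v\<^sub>k\<^sub>i exp(- \<i> f \<bullet> x\<^sub>k\<^sub>i)\<close>. The integrand is nonnegative, and by compactness of
  \<open>K \<times> \<Theta>\<close> it is at least \<open>\<epsilon> |U(f)|\<^sup>2\<close> for \<open>f\<close> in a compact box \<open>K\<close>. It remains to bound
  \<open>\<integral>\<^sub>K |U\<^sub>k|\<^sup>2\<close> below by a multiple of \<open>|v\<^sub>k|\<^sup>2\<close>, which is an Ingham-type inequality for separated
  frequencies: weighting by a product of bumps \<open>1 - (t/R)\<^sup>2\<close> on \<open>[-R, R]\<close> turns the integral into a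
  quadratic form whose off-diagonal rows are smaller than the diagonal by a factor \<open>R\<^sup>2\<close>, so for
  large \<open>R\<close> the diagonal dominates.\<close>

subsection \<open>Exponential sums with separated frequencies\<close>

text \<open>Fubini in coordinates: \<open>lborel\<close> is the image of a product of
  one-dimensional Lebesgue measures under
  \<open>f \<mapsto> \<Sum>b\<in>Basis. f b *\<^sub>R b\<close>, and after this substitution each
  factor depends on one coordinate only.\<close>

lemma lborel_integral_prod_Basis:
  fixes g :: "'a::euclidean_space \<Rightarrow> real \<Rightarrow> complex"
  assumes g: "\<And>b. b \<in> Basis \<Longrightarrow> integrable lborel (g b)"
  shows "integrable lborel (\<lambda>x::'a. \<Prod>b\<in>Basis. g b (inner x b))" (is ?int)
    and "(LINT x|lborel. (\<Prod>b\<in>Basis. g b (inner x b))) = (\<Prod>b\<in>Basis. (LINT t|lborel. g b t))" (is ?eq)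
proof -
  interpret product_sigma_finite "\<lambda>b::'a. lborel :: real measure" by standard
  have m [measurable]: "g b \<in> borel_measurable borel" if "b \<in> Basis" for b
    using g[OF that] by (simp add: integrable_iff_bounded)
  have [measurable]: "(\<lambda>x::'a. \<Prod>b\<in>Basis. g b (inner x b)) \<in> borel_measurable borel"
    by (intro borel_measurable_prod measurable_compose[OF _ m]) auto
  have [measurable]: "(\<lambda>f. \<Sum>b\<in>Basis. f b *\<^sub>R b) \<in> (\<Pi>\<^sub>M b\<in>(Basis::'a set). (lborel::real measure)) \<rightarrow>\<^sub>M borel"
    by measurable
  have eq: "(\<Prod>b\<in>Basis. g b (inner (\<Sum>b\<in>(Basis::'a set). f b *\<^sub>R b) b)) = (\<Prod>b\<in>Basis. g b (f b))" for f
    by (intro prod.cong) (auto simp: inner_sum_left_Basis)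
  show ?int
    unfolding lborel_eq[where 'a='a] by (subst integrable_distr_eq) (auto simp: eq intro!: product_integrable_prod g)
  show ?eq
    unfolding lborel_eq[where 'a='a] by (subst integral_distr) (auto simp: eq intro!: product_integral_prod g)
qed

section \<open>The parabolic bump and its Fourier transform\<close>

definition bump :: "real \<Rightarrow> real \<Rightarrow> real" where
  "bump R t = indicator {-R..R} t * (1 - (t / R)\<^sup>2)"

lemma bump_nonneg: "0 \<le> bump R t"
proof (cases "t \<in> {-R..R}")
  case True
  then have "\<bar>t\<bar> \<le> \<bar>R\<bar>" by auto
  then have "\<bar>t / R\<bar> \<le> 1" by (auto simp: divide_le_eq_1)
  then have "(t / R)\<^sup>2 \<le> 1" using abs_square_le_1 by blast
  then show ?thesis by (simp add: bump_def)
qed (simp add: bump_def)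

lemma bump_le_1: "bump R t \<le> 1"
  by (auto simp: bump_def indicator_def)

lemma bump_eq_0: "t \<notin> {-R..R} \<Longrightarrow> bump R t = 0"
  by (simp add: bump_def)

text \<open>Unnormalised and with a positive exponent: \<open>h\<close> will be a coordinate of a
  difference of two points, as it arises from expanding the squared modulus of an exponential
  sum.\<close>

definition bump_ft :: "real \<Rightarrow> real \<Rightarrow> complex" where
  "bump_ft R h = (LINT t|lborel. of_real (bump R t) * exp (\<i> * of_real (t * h)))"

lemma bump_integrable: "integrable lborel (\<lambda>t. complex_of_real (bump R t) * exp (\<i> * of_real (t * h)))"
proof -
  have "integrable lborel (\<lambda>t. indicator {-R..R} t *\<^sub>R (complex_of_real (1 - (t / R)\<^sup>2) * exp (\<i> * of_real (t * h))))"
    by (intro borel_integrable_compact) (auto intro!: continuous_intros simp: divide_inverse)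
  moreover have "indicator {-R..R} t *\<^sub>R (complex_of_real (1 - (t / R)\<^sup>2) * exp (\<i> * of_real (t * h)))
      = complex_of_real (bump R t) * exp (\<i> * of_real (t * h))" for t
    by (simp add: bump_def indicator_def)
  ultimately show ?thesis by simp
qed

lemma bump_ft_0:
  assumes "R > 0" shows "bump_ft R 0 = of_real (4 / 3 * R)"
proof -
  have "(LINT t|lborel. indicator {-R..R} t *\<^sub>R (1 - (t / R)\<^sup>2)) = (R - R ^ 3 / (3 * R\<^sup>2)) - ((-R) - (-R) ^ 3 / (3 * R\<^sup>2))"
    using assms
    by (intro integral_FTC_Icc)
       (auto intro!: continuous_intros derivative_eq_intros simp: has_real_derivative_iff_has_vector_derivative[symmetric] power2_eq_square power3_eq_cube field_simps)
  also have "\<dots> = 4 / 3 * R"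
    using assms by (simp add: power2_eq_square power3_eq_cube)
  finally have "(LINT t|lborel. bump R t) = 4 / 3 * R" by (simp add: bump_def)
  then show ?thesis by (simp only: bump_ft_def mult_zero_right of_real_0 exp_zero mult_1_right integral_complex_of_real)
qed

lemma bump_ft_trivial:
  assumes "R > 0" shows "cmod (bump_ft R h) \<le> 4 / 3 * R"
proof -
  have "cmod (bump_ft R h) \<le> (LINT t|lborel. bump R t)"
    unfolding bump_ft_def
    by (rule order.trans[OF integral_norm_bound]) (simp add: norm_mult bump_nonneg)
  also have "complex_of_real (LINT t|lborel. bump R t) = of_real (4 / 3 * R)"
    using bump_ft_0[OF assms] by (simp add: bump_ft_def)
  then have "(LINT t|lborel. bump R t) = 4 / 3 * R"
    by (simp only: of_real_eq_iff)
  finally show ?thesis .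
qed

text \<open>The parabola vanishes at the end points, so the first boundary term of repeated
  integration by parts drops out and the rest is of order \<open>1 / h\<^sup>2\<close>. The factor
  \<open>1 / R\<close> comes from the slope of the parabola at the end points, which is
  \<open>2 / R\<close> in modulus.\<close>

lemma bump_ft_decay:
  assumes R: "R > 0" and h: "h \<noteq> 0" shows "cmod (bump_ft R h) \<le> 8 / (R * h\<^sup>2)"
proof -
  define u where "u t = complex_of_real (1 - (t / R)\<^sup>2)" for t
  define e where "e t = exp (\<i> * complex_of_real (t * h))" for t
  \<comment> \<open>The antiderivative of \<open>u t * e t\<close> by repeated integration by parts;
    it stops after three terms because \<open>u\<close> is quadratic.\<close>
  define F where "F t = e t * (u t / (\<i> * h) + (2 * t / R\<^sup>2) / (\<i> * h)\<^sup>2 - (2 / R\<^sup>2) / (\<i> * h) ^ 3)" for t :: real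
  have e: "(e has_vector_derivative \<i> * h * e t) (at t within S)" for t S
    using exp_scaleR_has_vector_derivative_right[of "\<i> * h" t S]
    by (simp add: e_def[abs_def] scaleR_conv_of_real mult_ac)
  have u: "(u has_vector_derivative - of_real (2 * t / R\<^sup>2)) (at t within S)" for t S
    unfolding u_def using R
    by (auto intro!: derivative_eq_intros simp: has_real_derivative_iff_has_vector_derivative[symmetric] power2_eq_square field_simps simp flip: of_real_minus)
  define w where "w t = u t / (\<i> * h) + complex_of_real (2 * t / R\<^sup>2) / (\<i> * h)\<^sup>2 - (2 / R\<^sup>2) / (\<i> * h) ^ 3" for t
  have w: "(w has_vector_derivative (- of_real (2 * t / R\<^sup>2)) / (\<i> * h) + complex_of_real (2 / R\<^sup>2) / (\<i> * h)\<^sup>2) (at t within S)" for t S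
    unfolding w_def diff_conv_add_uminus
    by (rule has_vector_derivative_eq_rhs, (rule has_vector_derivative_add has_vector_derivative_divide u has_vector_derivative_const)+,
        auto intro!: has_vector_derivative_of_real derivative_eq_intros)
  have F: "(F has_vector_derivative u t * e t) (at t within S)" for t S
    using has_vector_derivative_mult[OF e w, of t S] h
    by (rule_tac has_vector_derivative_eq_rhs) (auto simp: F_def[abs_def] w_def field_simps power2_eq_square power3_eq_cube)
  have "bump_ft R h = (LINT t|lborel. indicator {-R..R} t *\<^sub>R (u t * e t))"
    unfolding bump_ft_def u_def e_def
    by (intro Bochner_Integration.integral_cong) (auto simp: bump_def indicator_def)
  also have "\<dots> = F R - F (-R)"
    using R by (intro integral_FTC_Icc F) (auto intro!: continuous_intros simp: u_def e_def)
  also have "\<dots> = (-2 / (R * h\<^sup>2)) * (e R + e (-R)) - (2 / (R\<^sup>2 * (\<i> * h) ^ 3)) * (e R - e (-R))"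
    using R h by (simp add: F_def u_def field_simps power2_eq_square)
  also have "cmod \<dots> \<le> 2 / (R * h\<^sup>2) * 2 + 2 / (R\<^sup>2 * \<bar>h\<bar> ^ 3) * (2 * R * \<bar>h\<bar>)"
  proof -
    have "cmod (e R + e (-R)) \<le> 2"
      by (rule order.trans[OF norm_triangle_ineq]) (simp add: e_def)
    \<comment> \<open>The sine bound cancels one power each of \<open>R\<close> and
      \<open>\<bar>h\<bar>\<close> in the cubic term, which then has the same size
      \<open>4 / (R * h\<^sup>2)\<close> as the other one.\<close>
    moreover have "cmod (e R - e (-R)) \<le> 2 * R * \<bar>h\<bar>"
    proof -
      have "e R - e (-R) = 2 * \<i> * of_real (sin (R * h))"
        unfolding e_def cis_conv_exp[symmetric] by (simp add: complex_eq_iff)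
      then have "cmod (e R - e (-R)) = 2 * \<bar>sin (R * h)\<bar>" by (simp add: norm_mult)
      also have "\<dots> \<le> 2 * \<bar>R * h\<bar>" using abs_sin_x_le_abs_x[of "R * h"] by simp
      finally show ?thesis using R by (simp add: abs_mult)
    qed
    moreover have "cmod (-2 / (R * h\<^sup>2)) = 2 / (R * h\<^sup>2)"
      and "cmod (2 / (R\<^sup>2 * (\<i> * h) ^ 3)) = 2 / (R\<^sup>2 * \<bar>h\<bar> ^ 3)"
      using R by (simp_all add: norm_mult norm_divide norm_power)
    moreover have "cmod (c * z) \<le> a * b" if "cmod c = a" "cmod z \<le> b" for c z a b
      using that by (auto simp: norm_mult intro: mult_left_mono)
    ultimately show ?thesis
      by (intro order.trans[OF norm_triangle_ineq4] add_mono) blast+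
  qed
  also have "\<dots> = 8 / (R * h\<^sup>2)"
    using R h by (simp add: field_simps power2_eq_square power3_eq_cube)
  finally show ?thesis .
qed

text \<open>One majorant has to serve all \<open>h\<close>, because in a product over coordinates
  only one coordinate is known to be at least \<open>D\<close> in modulus; that one gains
  \<open>R\<^sup>2\<close>. The constant 16 absorbs the decay bound, since there
  \<open>D\<^sup>2 + h\<^sup>2 \<le> 2 * h\<^sup>2\<close>, and \<open>4 * D\<^sup>2\<close> absorbs
  the trivial bound for \<open>\<bar>h\<bar> < D\<close>.\<close>

lemma bump_ft_le:
  assumes R: "R \<ge> 1" and D: "D > 0"
  shows "cmod (bump_ft R h) \<le> R * ((16 + 4 * D\<^sup>2) / (D\<^sup>2 + h\<^sup>2))"
    and "D \<le> \<bar>h\<bar> \<Longrightarrow> cmod (bump_ft R h) \<le> R * ((16 + 4 * D\<^sup>2) / (D\<^sup>2 + h\<^sup>2)) / R\<^sup>2"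
proof -
  have Dh: "D\<^sup>2 + h\<^sup>2 > 0" using D by (simp add: add_pos_nonneg)
  have far: "cmod (bump_ft R h) \<le> R * ((16 + 4 * D\<^sup>2) / (D\<^sup>2 + h\<^sup>2)) / R\<^sup>2" if "D \<le> \<bar>h\<bar>"
  proof -
    have h: "h \<noteq> 0" using that D by auto
    have "D\<^sup>2 \<le> h\<^sup>2" using that D by (simp add: abs_le_square_iff[symmetric])
    then have "8 * (D\<^sup>2 + h\<^sup>2) \<le> 16 * h\<^sup>2" by simp
    also have "\<dots> \<le> 16 * h\<^sup>2 + 4 * (D\<^sup>2 * h\<^sup>2)" by simp
    also have "\<dots> = (16 + 4 * D\<^sup>2) * h\<^sup>2" by (simp add: algebra_simps)
    finally have "8 * (D\<^sup>2 + h\<^sup>2) \<le> (16 + 4 * D\<^sup>2) * h\<^sup>2" .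
    then have "8 / h\<^sup>2 \<le> (16 + 4 * D\<^sup>2) / (D\<^sup>2 + h\<^sup>2)"
      using h Dh by (simp add: divide_le_eq le_divide_eq mult.commute)
    then have "8 / h\<^sup>2 / R \<le> (16 + 4 * D\<^sup>2) / (D\<^sup>2 + h\<^sup>2) / R"
      using R by (intro divide_right_mono) auto
    then show ?thesis
      using bump_ft_decay[of R h] R h by (simp add: power2_eq_square mult.commute)
  qed
  show "D \<le> \<bar>h\<bar> \<Longrightarrow> cmod (bump_ft R h) \<le> R * ((16 + 4 * D\<^sup>2) / (D\<^sup>2 + h\<^sup>2)) / R\<^sup>2"
    by (rule far)
  show "cmod (bump_ft R h) \<le> R * ((16 + 4 * D\<^sup>2) / (D\<^sup>2 + h\<^sup>2))"
  proof (cases "D \<le> \<bar>h\<bar>")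
    case True
    have "R * ((16 + 4 * D\<^sup>2) / (D\<^sup>2 + h\<^sup>2)) / R\<^sup>2 \<le> R * ((16 + 4 * D\<^sup>2) / (D\<^sup>2 + h\<^sup>2)) / 1"
      using R Dh by (intro divide_left_mono) auto
    then show ?thesis using far[OF True] by simp
  next
    case False
    then have "h\<^sup>2 \<le> D\<^sup>2" using D by (simp add: abs_le_square_iff[symmetric])
    then have "4 / 3 * (D\<^sup>2 + h\<^sup>2) \<le> 16 + 4 * D\<^sup>2"
      using zero_le_power2[of D] by argo
    then have "4 / 3 \<le> (16 + 4 * D\<^sup>2) / (D\<^sup>2 + h\<^sup>2)" using Dh by (simp add: le_divide_eq)
    then have "4 / 3 * R \<le> (16 + 4 * D\<^sup>2) / (D\<^sup>2 + h\<^sup>2) * R" using R by (intro mult_right_mono) auto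
    then show ?thesis using bump_ft_trivial[of R h] R by (simp add: mult.commute)
  qed
qed

section \<open>Lattice sums and separated points\<close>

lemma sum_int_inverse_squares_bounded:
  obtains T :: real where "T > 0" "\<And>B. finite B \<Longrightarrow> (\<Sum>k\<in>B. 1 / (1 + (real_of_int k)\<^sup>2)) \<le> T"
proof -
  define f where "f m = 1 / (1 + (real m)\<^sup>2)" for m :: nat
  have "summable (\<lambda>m. f (Suc m))"
    using summable_ignore_initial_segment[OF inverse_power_summable[of 2, where 'a=real], of 1]
    by (rule summable_comparison_test'[where N=0])
       (simp_all add: f_def divide_simps not_less add_nonneg_nonneg)
  then have f: "summable f" by (simp add: summable_Suc_iff)
  have f0: "f m \<ge> 0" for m by (simp add: f_def)
  \<comment> \<open>The absolute value is injective on the nonnegative and on the negative integers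
    separately, hence the factor 2 in the final bound.\<close>
  have part: "(\<Sum>k\<in>C. 1 / (1 + (real_of_int k)\<^sup>2)) \<le> suminf f"
    if "finite C" "inj_on (\<lambda>k. nat \<bar>k\<bar>) C" for C
  proof -
    have "(\<Sum>k\<in>C. 1 / (1 + (real_of_int k)\<^sup>2)) = (\<Sum>k\<in>C. f (nat \<bar>k\<bar>))"
      by (simp add: f_def)
    also have "\<dots> = sum f ((\<lambda>k. nat \<bar>k\<bar>) ` C)"
      using that by (simp add: sum.reindex)
    also have "\<dots> \<le> suminf f"
      using f f0 that by (intro sum_le_suminf) auto
    finally show ?thesis .
  qed
  show ?thesis
  proof
    have "f 0 \<le> suminf f" using sum_le_suminf[OF f, of "{0}"] f0 by simp
    then show "2 * suminf f > 0" by (simp add: f_def)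
    fix B :: "int set" assume B: "finite B"
    have "(\<Sum>k\<in>B. 1 / (1 + (real_of_int k)\<^sup>2)) =
        (\<Sum>k\<in>B \<inter> {0..}. 1 / (1 + (real_of_int k)\<^sup>2)) + (\<Sum>k\<in>B - {0..}. 1 / (1 + (real_of_int k)\<^sup>2))"
      using B by (rule sum.Int_Diff)
    also have "\<dots> \<le> suminf f + suminf f"
      using B by (intro add_mono part) (auto simp: inj_on_def)
    finally show "(\<Sum>k\<in>B. 1 / (1 + (real_of_int k)\<^sup>2)) \<le> 2 * suminf f" by simp
  qed
qed

text \<open>Stated for an indexed family, so that it can be imposed inside one component while
  points of different components coincide.\<close>

definition separated_on :: "real \<Rightarrow> 'i set \<Rightarrow> ('i \<Rightarrow> 'a::euclidean_space) \<Rightarrow> bool" where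
  "separated_on D J y \<longleftrightarrow> (\<forall>i\<in>J. \<forall>j\<in>J. i \<noteq> j \<longrightarrow> D \<le> infnorm (y i - y j))"

lemma le_infnorm_iff:
  fixes h :: "'a::euclidean_space"
  shows "D \<le> infnorm h \<longleftrightarrow> (\<exists>b\<in>Basis. D \<le> \<bar>inner h b\<bar>)"
  unfolding infnorm_Max by (subst Max_ge_iff) auto

text \<open>Rounding to a grid of mesh \<open>D\<close> sends separated points to distinct cells.
  Each summand is comparable with its value at the cell, and the sum over all cells is a power of
  the one-dimensional lattice sum, so the bound depends on \<open>D\<close> and the dimension
  only.\<close>

lemma separated_sum_bounded:
  assumes D: "D > 0"
  obtains S where "S > 0"
    "\<And>J (y :: 'i \<Rightarrow> 'a::euclidean_space) z. finite J \<Longrightarrow> separated_on D J y \<Longrightarrow>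
       (\<Sum>j\<in>J. \<Prod>b\<in>Basis. 1 / (D\<^sup>2 + (inner (y j - z) b)\<^sup>2)) \<le> S"
proof -
  obtain T :: real where T: "T > 0" "\<And>B. finite B \<Longrightarrow> (\<Sum>k\<in>B. 1 / (1 + (real_of_int k)\<^sup>2)) \<le> T"
    using sum_int_inverse_squares_bounded by blast
  show ?thesis
  proof
    show "(3 / D\<^sup>2 * T) ^ DIM('a) > 0" using D T by simp
    fix J and y :: "'i \<Rightarrow> 'a" and z
    assume J: "finite J" and sep: "separated_on D J y"
    \<comment> \<open>\<open>restrict\<close> makes each cell an extensional function, so that it
      can be a member of \<open>PiE\<close>.\<close>
    define n where "n j = restrict (\<lambda>b. \<lfloor>inner (y j - z) b / D\<rfloor>) Basis" for j
    define B where "B = (\<Union>j\<in>J. n j ` Basis)"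
    have B: "finite B" using J by (simp add: B_def)
    have inj: "inj_on n J"
    proof (rule inj_onI, rule ccontr)
      fix i j assume ij: "i \<in> J" "j \<in> J" "n i = n j" "i \<noteq> j"
      then obtain b where b: "b \<in> Basis" "D \<le> \<bar>inner (y i - y j) b\<bar>"
        using sep by (auto simp: separated_on_def le_infnorm_iff)
      have "\<lfloor>inner (y i - z) b / D\<rfloor> = \<lfloor>inner (y j - z) b / D\<rfloor>"
        using fun_cong[OF ij(3), of b] b by (simp add: n_def)
      then have "\<bar>inner (y i - z) b / D - inner (y j - z) b / D\<bar> < 1" by linarith
      then have "\<bar>inner (y i - y j) b / D\<bar> < 1"
        by (simp add: inner_diff_left diff_divide_distrib)
      then have "\<bar>inner (y i - y j) b\<bar> < D" using D by (simp add: abs_divide)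
      with b show False by simp
    qed
    \<comment> \<open>With \<open>r = \<lfloor>s\<rfloor>\<close> one has \<open>r\<^sup>2 \<le> 2 *
      s\<^sup>2 + 2 * (s - r)\<^sup>2 \<le> 2 * s\<^sup>2 + 2\<close>, whence the factor 3.\<close>
    have factor: "1 / (D\<^sup>2 + (inner (y j - z) b)\<^sup>2) \<le> 3 / D\<^sup>2 * (1 / (1 + (real_of_int (n j b))\<^sup>2))"
      if "b \<in> Basis" for j b
    proof -
      define s where "s = inner (y j - z) b / D"
      have n: "n j b = \<lfloor>s\<rfloor>" using that by (simp add: n_def s_def)
      have s: "inner (y j - z) b = s * D" using D by (simp add: s_def)
      define r where "r = real_of_int \<lfloor>s\<rfloor>"
      have "\<bar>s - r\<bar> \<le> 1" unfolding r_def by linarith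
      then have "(s - r)\<^sup>2 \<le> 1" by (simp add: abs_square_le_1)
      moreover have "r\<^sup>2 = 2 * s\<^sup>2 + 2 * (s - r)\<^sup>2 - (2 * s - r)\<^sup>2"
        by (simp add: power2_eq_square algebra_simps)
      ultimately have "1 + r\<^sup>2 \<le> 3 * (1 + s\<^sup>2)"
        using zero_le_power2[of s] zero_le_power2[of "2 * s - r"] by argo
      then have "1 / (1 + s\<^sup>2) \<le> 3 * (1 / (1 + r\<^sup>2))"
        by (simp add: divide_le_eq le_divide_eq add_pos_nonneg)
      then have "1 / (1 + s\<^sup>2) / D\<^sup>2 \<le> 3 * (1 / (1 + r\<^sup>2)) / D\<^sup>2"
        by (intro divide_right_mono) auto
      also have "1 / (1 + s\<^sup>2) / D\<^sup>2 = 1 / (D\<^sup>2 + (s * D)\<^sup>2)"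
        by (simp add: power_mult_distrib algebra_simps)
      finally show ?thesis by (simp add: n s r_def mult.commute)
    qed
    have "(\<Sum>j\<in>J. \<Prod>b\<in>Basis. 1 / (D\<^sup>2 + (inner (y j - z) b)\<^sup>2))
        \<le> (\<Sum>j\<in>J. \<Prod>b\<in>Basis. 3 / D\<^sup>2 * (1 / (1 + (real_of_int (n j b))\<^sup>2)))"
      using D by (intro sum_mono prod_mono conjI factor) auto
    also have "\<dots> = (\<Sum>g\<in>n ` J. \<Prod>b\<in>Basis. 3 / D\<^sup>2 * (1 / (1 + (real_of_int (g b))\<^sup>2)))"
      using inj by (simp add: sum.reindex)
    \<comment> \<open>Adding the unoccupied cells with coordinates in \<open>B\<close> completes a
      full product, over which the sum factorises.\<close>
    also have "\<dots> \<le> (\<Sum>g\<in>PiE (Basis :: 'a set) (\<lambda>_. B). \<Prod>b\<in>Basis. 3 / D\<^sup>2 * (1 / (1 + (real_of_int (g b))\<^sup>2)))"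
    proof (rule sum_mono2)
      show "finite (PiE (Basis :: 'a set) (\<lambda>_. B))" using B by (simp add: finite_PiE)
      show "n ` J \<subseteq> PiE Basis (\<lambda>_. B)" by (auto simp: n_def B_def)
    qed (simp add: prod_nonneg)
    also have "\<dots> = (\<Prod>b\<in>(Basis::'a set). \<Sum>k\<in>B. 3 / D\<^sup>2 * (1 / (1 + (real_of_int k)\<^sup>2)))"
      using B by (subst prod_sum_PiE) auto
    also have "\<dots> = (3 / D\<^sup>2 * (\<Sum>k\<in>B. 1 / (1 + (real_of_int k)\<^sup>2))) ^ DIM('a)"
      by (simp add: sum_distrib_left)
    also have "\<dots> \<le> (3 / D\<^sup>2 * T) ^ DIM('a)"
      using B D T by (intro power_mono mult_left_mono mult_nonneg_nonneg sum_nonneg) auto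
    finally show "(\<Sum>j\<in>J. \<Prod>b\<in>Basis. 1 / (D\<^sup>2 + (inner (y j - z) b)\<^sup>2)) \<le> (3 / D\<^sup>2 * T) ^ DIM('a)" .
  qed
qed

section \<open>The product weight and diagonal dominance\<close>

lemma product_bump_ft:
  fixes h :: "'a::euclidean_space"
  shows "integrable lborel (\<lambda>f::'a. of_real (\<Prod>b\<in>Basis. bump R (inner f b)) * exp (\<i> * of_real (inner f h)))" (is ?int)
    and "(LINT f|lborel. of_real (\<Prod>b\<in>Basis. bump R (inner f b)) * exp (\<i> * of_real (inner f h)))
           = (\<Prod>b\<in>Basis. bump_ft R (inner h b))" (is ?eq)
proof -
  have "complex_of_real (\<Prod>b\<in>Basis. bump R (inner f b)) * exp (\<i> * of_real (inner f h)) =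
      (\<Prod>b\<in>Basis. of_real (bump R (inner f b)) * exp (\<i> * of_real (inner f b * inner h b)))" for f
    by (subst euclidean_inner) (simp add: prod.distrib sum_distrib_left flip: exp_sum)
  then show ?int ?eq
    using lborel_integral_prod_Basis[where g="\<lambda>b t. of_real (bump R t) * exp (\<i> * of_real (t * inner h b))"]
    by (simp_all only: bump_integrable bump_ft_def)
qed

lemma product_bump_ft_0:
  assumes "R > 0"
  shows "(\<Prod>b\<in>(Basis::'a::euclidean_space set). bump_ft R (inner 0 b)) = of_real ((4 / 3 * R) ^ DIM('a))"
  using assms by (simp add: bump_ft_0)

text \<open>Separation in the maximum norm makes one coordinate of \<open>h\<close> at least
  \<open>D\<close> in modulus. That coordinate contributes the gain \<open>1 / R\<^sup>2\<close>;
  the others use the bound valid for every argument.\<close>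

lemma product_bump_ft_le:
  fixes h :: "'a::euclidean_space"
  assumes R: "R \<ge> 1" and D: "D > 0" "D \<le> infnorm h"
  shows "cmod (\<Prod>b\<in>Basis. bump_ft R (inner h b))
     \<le> (R * (16 + 4 * D\<^sup>2)) ^ DIM('a) / R\<^sup>2 * (\<Prod>b\<in>Basis. 1 / (D\<^sup>2 + (inner h b)\<^sup>2))"
proof -
  define w where "w b = R * ((16 + 4 * D\<^sup>2) / (D\<^sup>2 + (inner h b)\<^sup>2))" for b
  obtain m where m: "m \<in> Basis" "D \<le> \<bar>inner h m\<bar>"
    using D by (auto simp: le_infnorm_iff)
  have w: "w b \<ge> 0" for b
    using R by (simp add: w_def)
  have "cmod (\<Prod>b\<in>Basis. bump_ft R (inner h b))
      = cmod (bump_ft R (inner h m)) * (\<Prod>b\<in>Basis - {m}. cmod (bump_ft R (inner h b)))"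
    using m by (simp add: prod.remove norm_mult prod_norm)
  also have "\<dots> \<le> w m / R\<^sup>2 * (\<Prod>b\<in>Basis - {m}. w b)"
    using w m bump_ft_le(1)[OF R D(1), of "inner h b" for b] bump_ft_le(2)[OF R D(1) m(2)]
    unfolding w_def by (intro mult_mono prod_mono conjI prod_nonneg norm_ge_zero divide_nonneg_nonneg) auto
  also have "\<dots> = (\<Prod>b\<in>Basis. w b) / R\<^sup>2"
    using m by (simp add: prod.remove)
  also have "(\<Prod>b\<in>Basis. w b) = (\<Prod>b\<in>(Basis::'a set). R * (16 + 4 * D\<^sup>2)) * (\<Prod>b\<in>Basis. 1 / (D\<^sup>2 + (inner h b)\<^sup>2))"
    unfolding prod.distrib[symmetric] by (simp add: w_def)
  finally show ?thesis by simp
qed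

text \<open>A Schur test: \<open>cmod (v a) * cmod (v b)\<close> is at most the mean of the two
  squares, and by symmetry of \<open>\<beta>\<close> both halves reduce to row sums. The
  perturbation of the diagonal form therefore costs at most \<open>E\<close>.\<close>

lemma Re_quadratic_form_ge_dominant:
  fixes M :: "'i \<Rightarrow> 'i \<Rightarrow> complex" and v :: "'i \<Rightarrow> complex"
  assumes M: "\<And>a b. a \<in> J \<Longrightarrow> b \<in> J \<Longrightarrow> cmod (M a b - (if a = b then of_real d else 0)) \<le> \<beta> a b"
    and sym: "\<And>a b. \<beta> a b = \<beta> b a"
    and row: "\<And>a. a \<in> J \<Longrightarrow> (\<Sum>b\<in>J. \<beta> a b) \<le> E"
    and J: "finite J"
  shows "(d - E) * (\<Sum>a\<in>J. (cmod (v a))\<^sup>2) \<le> Re (\<Sum>a\<in>J. \<Sum>b\<in>J. v a * cnj (v b) * M a b)"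
proof -
  define N where "N a b = M a b - (if a = b then of_real d else 0)" for a b
  have \<beta>: "cmod (N a b) \<le> \<beta> a b" if "a \<in> J" "b \<in> J" for a b
    using M[OF that] by (simp add: N_def)
  have half: "(\<Sum>a\<in>J. \<Sum>b\<in>J. (cmod (v a))\<^sup>2 * \<beta> a b) \<le> E * (\<Sum>a\<in>J. (cmod (v a))\<^sup>2)"
    unfolding sum_distrib_left
    by (intro sum_mono) (simp add: mult.commute[of E] row mult_left_mono flip: sum_distrib_left)
  have half': "(\<Sum>a\<in>J. \<Sum>b\<in>J. (cmod (v b))\<^sup>2 * \<beta> a b) \<le> E * (\<Sum>a\<in>J. (cmod (v a))\<^sup>2)"
    using half by (subst sum.swap) (simp add: sym)
  have "cmod (\<Sum>a\<in>J. \<Sum>b\<in>J. v a * cnj (v b) * N a b) \<le> (\<Sum>a\<in>J. \<Sum>b\<in>J. cmod (v a) * cmod (v b) * \<beta> a b)"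
    by (intro sum_norm_le) (auto simp: norm_mult intro!: mult_left_mono \<beta>)
  also have "\<dots> \<le> (\<Sum>a\<in>J. \<Sum>b\<in>J. ((cmod (v a))\<^sup>2 * \<beta> a b + (cmod (v b))\<^sup>2 * \<beta> a b) / 2)"
  proof (intro sum_mono)
    fix a b assume ab: "a \<in> J" "b \<in> J"
    have "0 \<le> \<beta> a b" using \<beta>[OF ab] norm_ge_zero order_trans by blast
    moreover have "cmod (v a) * cmod (v b) \<le> ((cmod (v a))\<^sup>2 + (cmod (v b))\<^sup>2) / 2"
      using sum_squares_bound[of "cmod (v a)" "cmod (v b)"] by simp
    ultimately have "cmod (v a) * cmod (v b) * \<beta> a b \<le> ((cmod (v a))\<^sup>2 + (cmod (v b))\<^sup>2) / 2 * \<beta> a b"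
      by (intro mult_right_mono)
    then show "cmod (v a) * cmod (v b) * \<beta> a b \<le> ((cmod (v a))\<^sup>2 * \<beta> a b + (cmod (v b))\<^sup>2 * \<beta> a b) / 2"
      by (simp add: algebra_simps)
  qed
  also have "\<dots> \<le> E * (\<Sum>a\<in>J. (cmod (v a))\<^sup>2)"
    using half half' by (simp add: sum.distrib flip: sum_divide_distrib)
  finally have "- Re (\<Sum>a\<in>J. \<Sum>b\<in>J. v a * cnj (v b) * N a b) \<le> E * (\<Sum>a\<in>J. (cmod (v a))\<^sup>2)"
    using abs_Re_le_cmod[of "\<Sum>a\<in>J. \<Sum>b\<in>J. v a * cnj (v b) * N a b"] by linarith
  moreover have "(\<Sum>a\<in>J. \<Sum>b\<in>J. v a * cnj (v b) * M a b)
      = of_real (d * (\<Sum>a\<in>J. (cmod (v a))\<^sup>2)) + (\<Sum>a\<in>J. \<Sum>b\<in>J. v a * cnj (v b) * N a b)"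
  proof -
    have "(\<Sum>b\<in>J. v a * cnj (v b) * M a b) = of_real (d * (cmod (v a))\<^sup>2) + (\<Sum>b\<in>J. v a * cnj (v b) * N a b)"
      if "a \<in> J" for a
    proof -
      have "(\<Sum>b\<in>J. v a * cnj (v b) * M a b)
          = (\<Sum>b\<in>J. (if a = b then of_real d * (v a * cnj (v a)) else 0) + v a * cnj (v b) * N a b)"
        by (intro sum.cong) (auto simp: N_def algebra_simps)
      also have "\<dots> = of_real d * (v a * cnj (v a)) + (\<Sum>b\<in>J. v a * cnj (v b) * N a b)"
        using that J by (simp add: sum.distrib)
      also have "of_real d * (v a * cnj (v a)) = complex_of_real (d * (cmod (v a))\<^sup>2)"
        by (simp only: of_real_mult complex_norm_square)
      finally show ?thesis .
    qed
    then show ?thesis by (simp add: sum.distrib sum_distrib_left)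
  qed
  ultimately show ?thesis by (simp add: left_diff_distrib)
qed

text \<open>The box and the constant are chosen before \<open>J\<close>, \<open>y\<close> and
  \<open>v\<close>; this independence of the number of points is what makes the final bound uniform
  in the sample sizes.\<close>

lemma exponential_sum_lower_bound:
  assumes D: "D > 0"
  obtains K :: "'a::euclidean_space set" and \<kappa> where "compact K" "\<kappa> > 0"
    "\<And>J (y :: 'i \<Rightarrow> 'a) v. finite J \<Longrightarrow> separated_on D J y \<Longrightarrow>
       \<kappa> * (\<Sum>j\<in>J. (cmod (v j))\<^sup>2)
         \<le> (LINT f|lborel. indicator K f * (cmod (\<Sum>j\<in>J. v j * exp (- (\<i> * of_real (inner f (y j))))))\<^sup>2)"
proof -
  obtain S where S: "S > 0"
    "\<And>J (y :: 'i \<Rightarrow> 'a) z. finite J \<Longrightarrow> separated_on D J y \<Longrightarrow>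
       (\<Sum>j\<in>J. \<Prod>b\<in>Basis. 1 / (D\<^sup>2 + (inner (y j - z) b)\<^sup>2)) \<le> S"
    using separated_sum_bounded[OF D] by blast
  define B where "B = (16 + 4 * D\<^sup>2) ^ DIM('a) * S"
  have "B > 0" using S(1) by (simp add: B_def add_pos_nonneg)
  \<comment> \<open>Chosen so that \<open>R \<ge> 1\<close> and
    \<open>2 * B \<le> R\<^sup>2\<close>: off-diagonal rows then sum to at most
    \<open>R ^ DIM('a) / 2\<close>, while the diagonal entry \<open>(4 / 3 * R) ^ DIM('a)\<close> is
    at least \<open>R ^ DIM('a)\<close>.\<close>
  define R where "R = 1 + 2 * B"
  have R: "R \<ge> 1" "2 * B \<le> R\<^sup>2"
    using \<open>B > 0\<close> by (auto simp: R_def power2_eq_square algebra_simps add_nonneg_nonneg)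
  define K :: "'a set" where "K = cbox (- (\<Sum>b\<in>Basis. R *\<^sub>R b)) (\<Sum>b\<in>Basis. R *\<^sub>R b)"
  define \<phi> where "\<phi> f = (\<Prod>b\<in>Basis. bump R (inner f b))" for f :: 'a
  have \<phi>_nonneg: "0 \<le> \<phi> f" for f by (simp add: \<phi>_def prod_nonneg bump_nonneg)
  have \<phi>_le: "\<phi> f \<le> indicator K f" for f
  proof (cases "f \<in> K")
    case True
    then show ?thesis by (auto simp: \<phi>_def intro!: prod_le_1 bump_nonneg bump_le_1)
  next
    case False
    then obtain b where "b \<in> Basis" "inner f b \<notin> {-R..R}" by (auto simp: K_def mem_box)
    then have "\<phi> f = 0" by (auto simp: \<phi>_def intro!: prod_zero bump_eq_0 bexI[of _ b])
    then show ?thesis by simp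
  qed
  show ?thesis
  proof
    show "compact K" by (simp add: K_def)
    show "R ^ DIM('a) / 2 > 0" using R by simp
    fix J and y :: "'i \<Rightarrow> 'a" and v
    assume J: "finite J" and sep: "separated_on D J y"
    define U where "U f = (\<Sum>j\<in>J. v j * exp (- (\<i> * of_real (inner f (y j)))))" for f
    define G where "G h = (\<Prod>b\<in>Basis. bump_ft R (inner h b))" for h :: 'a
    define \<beta> where "\<beta> a b = (if a = b then 0 else (R * (16 + 4 * D\<^sup>2)) ^ DIM('a) / R\<^sup>2 *
        (\<Prod>i\<in>Basis. 1 / (D\<^sup>2 + (inner (y b - y a) i)\<^sup>2)))" for a b
    have expand: "of_real (\<phi> f * (cmod (U f))\<^sup>2) =
       (\<Sum>a\<in>J. \<Sum>b\<in>J. v a * cnj (v b) * (of_real (\<phi> f) * exp (\<i> * of_real (inner f (y b - y a)))))" for f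
    proof -
      have "exp (\<i> * of_real (inner f (y b - y a))) =
          exp (- (\<i> * of_real (inner f (y a)))) * cnj (exp (- (\<i> * of_real (inner f (y b)))))" for a b
        by (simp add: exp_cnj inner_diff_right exp_add[symmetric] algebra_simps)
      then show ?thesis
        unfolding of_real_mult complex_norm_square
        by (simp add: U_def sum_product sum_distrib_left mult_ac) (rule sum.swap)
    qed
    have G: "integrable lborel (\<lambda>f. of_real (\<phi> f) * exp (\<i> * of_real (inner f h)))"
        "(LINT f|lborel. of_real (\<phi> f) * exp (\<i> * of_real (inner f h))) = G h" for h
      unfolding \<phi>_def G_def by (rule product_bump_ft)+
    have int: "integrable lborel (\<lambda>f. complex_of_real (\<phi> f * (cmod (U f))\<^sup>2))"
      unfolding expand by (intro Bochner_Integration.integrable_sum integrable_mult_right G)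
    have "complex_of_real (LINT f|lborel. \<phi> f * (cmod (U f))\<^sup>2) = (\<Sum>a\<in>J. \<Sum>b\<in>J. v a * cnj (v b) * G (y b - y a))"
      unfolding integral_complex_of_real[symmetric] expand
      by (simp add: G integrable_mult_right)
    then have Q: "(LINT f|lborel. \<phi> f * (cmod (U f))\<^sup>2) = Re (\<Sum>a\<in>J. \<Sum>b\<in>J. v a * cnj (v b) * G (y b - y a))"
      by (metis Re_complex_of_real)
    have row: "(\<Sum>b\<in>J. \<beta> a b) \<le> R ^ DIM('a) / 2" if "a \<in> J" for a
    proof -
      have "(\<Sum>b\<in>J. \<beta> a b) \<le> (\<Sum>b\<in>J. (R * (16 + 4 * D\<^sup>2)) ^ DIM('a) / R\<^sup>2 *
          (\<Prod>i\<in>Basis. 1 / (D\<^sup>2 + (inner (y b - y a) i)\<^sup>2)))"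
        using R by (intro sum_mono) (auto simp: \<beta>_def intro!: prod_nonneg mult_nonneg_nonneg)
      also have "\<dots> \<le> (R * (16 + 4 * D\<^sup>2)) ^ DIM('a) / R\<^sup>2 * S"
        unfolding sum_distrib_left[symmetric] using R by (intro mult_left_mono S(2) J sep) auto
      also have "\<dots> = R ^ DIM('a) * B / R\<^sup>2"
        by (simp add: B_def power_mult_distrib)
      also have "\<dots> \<le> R ^ DIM('a) / 2"
      proof -
        have "B / R\<^sup>2 \<le> 1 / 2" using R by (simp add: divide_le_eq)
        then have "R ^ DIM('a) * (B / R\<^sup>2) \<le> R ^ DIM('a) * (1 / 2)" using R by (intro mult_left_mono) auto
        then show ?thesis by simp
      qed
      finally show ?thesis .
    qed
    have entry: "cmod (G (y b - y a) - (if a = b then of_real ((4 / 3 * R) ^ DIM('a)) else 0)) \<le> \<beta> a b"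
      if "a \<in> J" "b \<in> J" for a b
    proof (cases "a = b")
      case True
      then show ?thesis using product_bump_ft_0[of R, where 'a='a] R by (simp add: \<beta>_def G_def)
    next
      case False
      then have "D \<le> infnorm (y b - y a)" using sep that by (simp add: separated_on_def)
      with False show ?thesis
        using product_bump_ft_le[OF R(1) D] by (simp add: \<beta>_def G_def)
    qed
    have "\<beta> a b = \<beta> b a" for a b
      unfolding \<beta>_def inner_diff_left by (subst (1 2) power2_commute) (simp add: power2_commute)
    then have "((4 / 3 * R) ^ DIM('a) - R ^ DIM('a) / 2) * (\<Sum>a\<in>J. (cmod (v a))\<^sup>2) \<le> (LINT f|lborel. \<phi> f * (cmod (U f))\<^sup>2)"
      unfolding Q using entry row J by (intro Re_quadratic_form_ge_dominant[where \<beta>=\<beta>]) auto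
    moreover have "R ^ DIM('a) / 2 * (\<Sum>a\<in>J. (cmod (v a))\<^sup>2)
        \<le> ((4 / 3 * R) ^ DIM('a) - R ^ DIM('a) / 2) * (\<Sum>a\<in>J. (cmod (v a))\<^sup>2)"
    proof (intro mult_right_mono sum_nonneg)
      have "R ^ DIM('a) \<le> (4 / 3 * R) ^ DIM('a)" using R by (intro power_mono) auto
      then show "R ^ DIM('a) / 2 \<le> (4 / 3 * R) ^ DIM('a) - R ^ DIM('a) / 2" by simp
    qed auto
    moreover have "(LINT f|lborel. \<phi> f * (cmod (U f))\<^sup>2) \<le> (LINT f|lborel. indicator K f * (cmod (U f))\<^sup>2)"
    proof (rule integral_mono)
      show "integrable lborel (\<lambda>f. \<phi> f * (cmod (U f))\<^sup>2)"
        using int by (simp only: complex_of_real_integrable_eq)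
      have "continuous_on K (\<lambda>f. (cmod (U f))\<^sup>2)"
        unfolding U_def by (intro continuous_intros)
      then show "integrable lborel (\<lambda>f. indicator K f * (cmod (U f))\<^sup>2)"
        using borel_integrable_compact[of K "\<lambda>f. (cmod (U f))\<^sup>2"] by (simp add: K_def)
    qed (intro mult_right_mono \<phi>_le, simp)
    ultimately show "R ^ DIM('a) / 2 * (\<Sum>j\<in>J. (cmod (v j))\<^sup>2)
         \<le> (LINT f|lborel. indicator K f * (cmod (\<Sum>j\<in>J. v j * exp (- (\<i> * of_real (inner f (y j))))))\<^sup>2)"
      unfolding U_def by linarith
  qed
qed

subsection \<open>Hermitian forms and smallest eigenvalues\<close>

text \<open>Vectors are functions on \<open>nat\<close>, so that the product topology supplies
  compactness and continuity; values at indices from \<open>n\<close> on do not enter.\<close>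

definition sesq_form :: "nat \<Rightarrow> (nat \<Rightarrow> nat \<Rightarrow> complex) \<Rightarrow> (nat \<Rightarrow> complex) \<Rightarrow> (nat \<Rightarrow> complex) \<Rightarrow> complex" where
  "sesq_form n A u w = (\<Sum>k<n. \<Sum>l<n. cnj (u k) * A k l * w l)"

definition hermitian_on :: "nat \<Rightarrow> (nat \<Rightarrow> nat \<Rightarrow> complex) \<Rightarrow> bool" where
  "hermitian_on n A \<longleftrightarrow> (\<forall>k<n. \<forall>l<n. A l k = cnj (A k l))"

definition sq_norm_fun :: "nat \<Rightarrow> (nat \<Rightarrow> complex) \<Rightarrow> real" where
  "sq_norm_fun n v = (\<Sum>k<n. (cmod (v k))\<^sup>2)"

lemma sq_norm_fun_nonneg: "0 \<le> sq_norm_fun n v"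
  by (simp add: sq_norm_fun_def sum_nonneg)

lemma sq_norm_fun_eq_0_iff: "sq_norm_fun n v = 0 \<longleftrightarrow> (\<forall>k<n. v k = 0)"
  by (simp add: sq_norm_fun_def sum_nonneg_eq_0_iff Ball_def)

lemma cnj_hermitian_on: "hermitian_on n A \<Longrightarrow> k < n \<Longrightarrow> l < n \<Longrightarrow> cnj (A k l) = A l k"
  unfolding hermitian_on_def by metis

lemma sesq_form_cnj:
  assumes "hermitian_on n A"
  shows "cnj (sesq_form n A u w) = sesq_form n A w u"
proof -
  have "cnj (sesq_form n A u w) = (\<Sum>k<n. \<Sum>l<n. cnj (w l) * A l k * u k)"
    unfolding sesq_form_def cnj_sum by (intro sum.cong) (simp_all add: cnj_hermitian_on[OF assms] mult_ac)
  also have "\<dots> = sesq_form n A w u"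
    unfolding sesq_form_def by (rule sum.swap)
  finally show ?thesis .
qed

lemma sesq_form_eigen:
  assumes "\<And>k. k < n \<Longrightarrow> (\<Sum>l<n. A k l * v l) = z * v k"
  shows "sesq_form n A v v = z * of_real (sq_norm_fun n v)"
proof -
  have "sesq_form n A v v = (\<Sum>k<n. cnj (v k) * (\<Sum>l<n. A k l * v l))"
    by (simp add: sesq_form_def sum_distrib_left mult_ac)
  also have "\<dots> = (\<Sum>k<n. z * of_real ((cmod (v k))\<^sup>2))"
    by (intro sum.cong refl) (simp only: assms complex_norm_square lessThan_iff, simp only: mult_ac)
  finally show ?thesis by (simp add: sq_norm_fun_def sum_distrib_left)
qed

lemma sesq_form_scale:
  "sesq_form n A (\<lambda>k. of_real r * v k) (\<lambda>k. of_real r * v k) = of_real (r\<^sup>2) * sesq_form n A v v"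
  by (simp add: sesq_form_def sum_distrib_left power2_eq_square mult_ac)

lemma sq_norm_fun_scale: "sq_norm_fun n (\<lambda>k. of_real r * v k) = r\<^sup>2 * sq_norm_fun n v"
  by (simp add: sq_norm_fun_def sum_distrib_left norm_mult power_mult_distrib)

text \<open>The gradient of the Rayleigh quotient vanishes at a minimiser: otherwise moving against the
  residual \<open>r = (A - m) v\<close> would decrease the quotient.\<close>

lemma minimiser_is_eigenvector:
  assumes herm: "hermitian_on n A"
    and min: "\<And>w. m * sq_norm_fun n w \<le> Re (sesq_form n A w w)"
    and v: "Re (sesq_form n A v v) = m * sq_norm_fun n v"
    and k: "k < n"
  shows "(\<Sum>l<n. A k l * v l) = of_real m * v k"
proof -
  define r where "r k = (\<Sum>l<n. A k l * v l) - of_real m * v k" for k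
  \<comment> \<open>With \<open>B = A - m\<close> the hypotheses say that the form of
    \<open>B\<close> is nonnegative and vanishes at \<open>v\<close>, while the residual is
    \<open>B v\<close>.\<close>
  define B where "B k l = A k l - (if k = l then of_real m else 0)" for k l
  have B: "hermitian_on n B" 
    unfolding hermitian_on_def B_def by (simp add: cnj_hermitian_on[OF herm])
  have Bv: "(\<Sum>l<n. B k l * v l) = r k" if "k < n" for k
  proof -
    have "(\<Sum>l<n. B k l * v l) = (\<Sum>l<n. A k l * v l) - (\<Sum>l<n. if k = l then of_real m * v l else 0)"
      unfolding sum_subtractf[symmetric] by (intro sum.cong) (auto simp: B_def left_diff_distrib)
    with that show ?thesis by (simp add: r_def)
  qed
  have Bform: "Re (sesq_form n B w w) = Re (sesq_form n A w w) - m * sq_norm_fun n w" for w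
  proof -
    have "(\<Sum>l<n. cnj (w k) * B k l * w l) = (\<Sum>l<n. cnj (w k) * A k l * w l) - of_real (m * (cmod (w k))\<^sup>2)"
      if "k < n" for k
    proof -
      have "(\<Sum>l<n. cnj (w k) * B k l * w l) = (\<Sum>l<n. cnj (w k) * A k l * w l) -
          (\<Sum>l<n. if k = l then of_real m * (w l * cnj (w l)) else 0)"
        unfolding sum_subtractf[symmetric] by (intro sum.cong) (auto simp: B_def algebra_simps)
      with that show ?thesis by (simp only: of_real_mult complex_norm_square) simp
    qed
    then show ?thesis by (simp add: sesq_form_def sq_norm_fun_def sum_subtractf sum_distrib_left)
  qed
  then have Bpos: "0 \<le> Re (sesq_form n B w w)" for w using min by simp
  have rv: "sesq_form n B r v = of_real (sq_norm_fun n r)"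
  proof -
    have "sesq_form n B r v = (\<Sum>k<n. cnj (r k) * (\<Sum>l<n. B k l * v l))"
      by (simp add: sesq_form_def sum_distrib_left mult_ac)
    also have "\<dots> = (\<Sum>k<n. of_real ((cmod (r k))\<^sup>2))"
      by (intro sum.cong refl) (simp only: Bv complex_norm_square lessThan_iff, simp only: mult_ac)
    finally show ?thesis by (simp add: sq_norm_fun_def)
  qed
  then have vr: "sesq_form n B v r = of_real (sq_norm_fun n r)"
    using sesq_form_cnj[OF B, of r v] by simp
  have expand: "Re (sesq_form n B (\<lambda>k. v k - of_real t * r k) (\<lambda>k. v k - of_real t * r k))
      = t\<^sup>2 * Re (sesq_form n B r r) - 2 * t * sq_norm_fun n r" for t
  proof -
    have "cnj (v k - of_real t * r k) * B k l * (v l - of_real t * r l)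
        = cnj (v k) * B k l * v l - of_real t * (cnj (v k) * B k l * r l) - of_real t * (cnj (r k) * B k l * v l)
          + of_real (t\<^sup>2) * (cnj (r k) * B k l * r l)" for k l
      by (simp add: algebra_simps power2_eq_square)
    then have "sesq_form n B (\<lambda>k. v k - of_real t * r k) (\<lambda>k. v k - of_real t * r k)
        = sesq_form n B v v - of_real t * sesq_form n B v r - of_real t * sesq_form n B r v
          + of_real (t\<^sup>2) * sesq_form n B r r"
      unfolding sesq_form_def by (simp only: sum.distrib sum_subtractf sum_distrib_left)
    then show ?thesis using v Bform[of v] by (simp add: vr rv)
  qed
  have "sq_norm_fun n r \<le> 0"
  proof (rule ccontr)
    assume "\<not> sq_norm_fun n r \<le> 0"
    then have s: "sq_norm_fun n r > 0" by simp
    \<comment> \<open>The \<open>+ 1\<close> keeps the divisor of \<open>t\<close> positive; with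
      this \<open>t\<close> the quadratic term is at most half of the linear one, which leaves a
      negative value.\<close>
    define c where "c = \<bar>Re (sesq_form n B r r)\<bar> + 1"
    have c: "c > 0" "Re (sesq_form n B r r) \<le> c" by (auto simp: c_def)
    define t where "t = sq_norm_fun n r / c"
    have t: "t > 0" using s c by (simp add: t_def)
    have "0 \<le> t\<^sup>2 * Re (sesq_form n B r r) - 2 * t * sq_norm_fun n r"
      unfolding expand[symmetric] by (rule Bpos)
    also have "\<dots> \<le> t\<^sup>2 * c - 2 * t * sq_norm_fun n r"
      using c by (simp add: mult_left_mono)
    also have "\<dots> = - t * sq_norm_fun n r"
      using c by (simp add: t_def power2_eq_square)
    finally show False using t s by (simp add: zero_le_mult_iff mult_le_0_iff)
  qed
  then have "r k = 0"
    using sq_norm_fun_nonneg[of n r] sq_norm_fun_eq_0_iff[of n r] k by auto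
  then show ?thesis by (simp add: r_def)
qed

text \<open>Fixing the coordinates from \<open>n\<close> on to 0 is what gives compactness: the set
  is a closed part of a product of closed discs and singletons, which is compact by
  Tychonoff.\<close>

lemma compact_unit_sphere_fun:
  "compact {v :: nat \<Rightarrow> complex. sq_norm_fun n v = 1 \<and> (\<forall>k\<ge>n. v k = 0)}"
proof -
  let ?P = "PiE UNIV (\<lambda>k. if k < n then cball 0 1 else {0 :: complex})"
  have "compactin (product_topology (\<lambda>i. euclidean) UNIV) ?P"
    unfolding compactin_PiE by auto
  then have P: "compact ?P"
    by (simp add: euclidean_product_topology)
  have "closed {v :: nat \<Rightarrow> complex. sq_norm_fun n v = 1}"
    unfolding sq_norm_fun_def
    by (intro closed_Collect_eq continuous_intros continuous_on_product_coordinates)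
  then have "compact (?P \<inter> {v. sq_norm_fun n v = 1})"
    by (rule compact_Int_closed[OF P])
  also have "?P \<inter> {v. sq_norm_fun n v = 1} = {v. sq_norm_fun n v = 1 \<and> (\<forall>k\<ge>n. v k = 0)}"
  proof (intro equalityI subsetI)
    fix v assume v: "v \<in> {v :: nat \<Rightarrow> complex. sq_norm_fun n v = 1 \<and> (\<forall>k\<ge>n. v k = 0)}"
    have "cmod (v k) \<le> 1" if "k < n" for k
    proof -
      have "(cmod (v k))\<^sup>2 \<le> sq_norm_fun n v"
        unfolding sq_norm_fun_def using that by (intro member_le_sum) auto
      with v show ?thesis by (simp add: power_le_one_iff)
    qed
    with v show "v \<in> ?P \<inter> {v. sq_norm_fun n v = 1}" by auto
  qed (auto simp: PiE_iff not_less split: if_splits)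
  finally show ?thesis .
qed

text \<open>The form is minimised over the parameter and the unit sphere at once. With the
  minimising parameter held fixed, the minimising vector is an eigenvector whose eigenvalue is the
  minimum, so \<open>pos\<close> makes the minimum positive; homogeneity extends the bound to all
  vectors.\<close>

lemma hermitian_family_lower_bound:
  fixes A :: "'s::topological_space \<Rightarrow> nat \<Rightarrow> nat \<Rightarrow> complex"
  assumes X: "compact X"
    and cont: "\<And>k l. k < n \<Longrightarrow> l < n \<Longrightarrow> continuous_on X (\<lambda>s. A s k l)"
    and herm: "\<And>s. s \<in> X \<Longrightarrow> hermitian_on n (A s)"
    and pos: "\<And>s m v. s \<in> X \<Longrightarrow> sq_norm_fun n v \<noteq> 0 \<Longrightarrow>
        (\<And>k. k < n \<Longrightarrow> (\<Sum>l<n. A s k l * v l) = of_real m * v k) \<Longrightarrow> m > 0"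
  obtains \<epsilon> :: real where "\<epsilon> > 0" "\<And>s v. s \<in> X \<Longrightarrow> \<epsilon> * sq_norm_fun n v \<le> Re (sesq_form n (A s) v v)"
proof (cases "X = {} \<or> n = 0")
  case True
  \<comment> \<open>Here \<open>X\<close> or the unit sphere is empty, so there is no minimum to
    take; any positive constant works.\<close>
  then show ?thesis using that[of 1] by (auto simp: sq_norm_fun_def sesq_form_def)
next
  case False
  define S where "S = {v :: nat \<Rightarrow> complex. sq_norm_fun n v = 1 \<and> (\<forall>k\<ge>n. v k = 0)}"
  have "(\<lambda>k. if k = 0 then 1 else 0) \<in> S"
  proof -
    have "sq_norm_fun n (\<lambda>k. if k = 0 then 1 else 0) = (\<Sum>k<n. if k = 0 then 1 else 0)"
      unfolding sq_norm_fun_def by (intro sum.cong) auto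
    with False show ?thesis by (auto simp: S_def)
  qed
  then have ne: "X \<times> S \<noteq> {}" using False by auto
  have comp: "compact (X \<times> S)"
    unfolding S_def by (intro compact_Times X compact_unit_sphere_fun)
  have cont_form: "continuous_on (X \<times> S) (\<lambda>z. Re (sesq_form n (A (fst z)) (snd z) (snd z)))"
  proof -
    have A_cont: "continuous_on (X \<times> S) (\<lambda>z. A (fst z) k l)" if "k < n" "l < n" for k l
    proof -
      have "fst ` (X \<times> S) \<subseteq> X" by force
      then have "continuous_on (fst ` (X \<times> S)) (\<lambda>s. A s k l)"
        by (rule continuous_on_subset[OF cont[OF that]])
      from continuous_on_compose[OF continuous_on_fst[OF continuous_on_id] this]
      show ?thesis unfolding o_def .
    qed
    have v_cont: "continuous_on (X \<times> S) (\<lambda>z. snd z k)" for k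
    proof -
      have "continuous_on (snd ` (X \<times> S)) (\<lambda>v :: nat \<Rightarrow> complex. v k)"
        by (rule continuous_on_subset[OF continuous_on_product_coordinates subset_UNIV])
      from continuous_on_compose[OF continuous_on_snd[OF continuous_on_id] this]
      show ?thesis unfolding o_def .
    qed
    show ?thesis
      unfolding sesq_form_def
      by (intro continuous_on_Re continuous_on_sum continuous_on_mult continuous_on_cnj A_cont v_cont) simp_all
  qed
  from continuous_attains_inf[OF comp ne cont_form] obtain z where z: "z \<in> X \<times> S"
    and z_min: "\<forall>y\<in>X \<times> S. Re (sesq_form n (A (fst z)) (snd z) (snd z)) \<le> Re (sesq_form n (A (fst y)) (snd y) (snd y))"
    by (rule bexE)
  define m where "m = Re (sesq_form n (A (fst z)) (snd z) (snd z))"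
  have bound: "m * sq_norm_fun n v \<le> Re (sesq_form n (A s) v v)" if s: "s \<in> X" for s v
  proof (cases "sq_norm_fun n v = 0")
    case True
    then have "v k = 0" if "k < n" for k using that by (simp add: sq_norm_fun_eq_0_iff)
    then show ?thesis by (simp add: True sesq_form_def)
  next
    case False
    define N where "N = sq_norm_fun n v"
    have N: "N > 0" using False sq_norm_fun_nonneg[of n v] by (simp add: N_def)
    \<comment> \<open>\<open>v\<close> may be nonzero from index \<open>n\<close> on, whereas
      \<open>S\<close> asks for zeros there; truncation changes neither the form nor the
      norm.\<close>
    define u where "u k = (if k < n then v k else 0)" for k
    have u: "sesq_form n (A s) u u = sesq_form n (A s) v v" "sq_norm_fun n u = N"
      unfolding sesq_form_def N_def sq_norm_fun_def by (intro sum.cong refl; simp add: u_def)+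
    define r where "r = 1 / sqrt N"
    have r: "r\<^sup>2 = 1 / N" using N by (simp add: r_def power_divide)
    have "sq_norm_fun n (\<lambda>k. of_real r * u k) = 1"
      unfolding sq_norm_fun_scale r u(2) using N by simp
    moreover have "\<forall>k\<ge>n. of_real r * u k = 0" by (simp add: u_def)
    ultimately have "(\<lambda>k. of_real r * u k) \<in> S"
      unfolding S_def by blast
    with s have "(s, \<lambda>k. of_real r * u k) \<in> X \<times> S" by (rule SigmaI)
    from bspec[OF z_min this] have "m \<le> r\<^sup>2 * Re (sesq_form n (A s) u u)"
      unfolding m_def fst_conv snd_conv sesq_form_scale by simp
    then have "m \<le> 1 / N * Re (sesq_form n (A s) v v)"
      unfolding r u(1) .
    then have "m * N \<le> Re (sesq_form n (A s) v v)" using N by (simp add: pos_le_divide_eq)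
    then show ?thesis unfolding N_def .
  qed
  have zX: "fst z \<in> X" and zS: "snd z \<in> S" using z by (simp_all add: mem_Times_iff)
  have v1: "sq_norm_fun n (snd z) = 1" using zS by (simp add: S_def)
  have "(\<Sum>l<n. A (fst z) k l * snd z l) = of_real m * snd z k" if k: "k < n" for k
  proof (rule minimiser_is_eigenvector[OF herm[OF zX] bound[OF zX] _ k])
    show "Re (sesq_form n (A (fst z)) (snd z) (snd z)) = m * sq_norm_fun n (snd z)"
      unfolding v1 m_def by simp
  qed
  then have "m > 0"
    using v1 by (intro pos[OF zX, where v="snd z"]) simp_all
  then show ?thesis using bound by (rule that)
qed

section \<open>Smallest eigenvalues of matrices\<close>

lemma finite_real_eigenvalues:
  fixes A :: "complex mat"
  assumes "A \<in> carrier_mat n n"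
  shows "finite {x :: real. eigenvalue A (of_real x)}"
proof -
  have "{x :: real. eigenvalue A (of_real x)} = complex_of_real -` spectrum A"
    by (auto simp: spectrum_def)
  then show ?thesis
    using card_finite_spectrum(1)[OF assms] by (simp add: finite_vimageI inj_on_def)
qed

text \<open>Carries positivity of \<open>lambda_1\<close> over to every real eigenvalue given by
  coordinate equations; finiteness of the set of real eigenvalues makes \<open>Min\<close> a lower
  bound.\<close>

lemma lambda_1_le:
  assumes A: "A \<in> carrier_mat n n" and v: "sq_norm_fun n v \<noteq> 0"
    and eq: "\<And>k. k < n \<Longrightarrow> (\<Sum>l<n. A $$ (k, l) * v l) = of_real m * v k"
  shows "lambda_1 A \<le> m"
proof -
  have "eigenvector A (Matrix.vec n v) (of_real m)"
    unfolding eigenvector_def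
  proof (intro conjI)
    show "Matrix.vec n v \<in> carrier_vec (dim_row A)" using A by simp
    show "Matrix.vec n v \<noteq> 0\<^sub>v (dim_row A)"
      using v A unfolding sq_norm_fun_eq_0_iff by (metis carrier_matD(1) index_vec index_zero_vec(1))
    show "A *\<^sub>v Matrix.vec n v = of_real m \<cdot>\<^sub>v Matrix.vec n v"
      using A eq by (intro eq_vecI) (auto simp: scalar_prod_def atLeast0LessThan)
  qed
  then show ?thesis
    unfolding lambda_1_def by (intro Min_le finite_real_eigenvalues[OF A]) (auto simp: eigenvalue_def)
qed

text \<open>On an eigenvector the form equals the eigenvalue times the squared norm, and it is real
  because the matrix is Hermitian; so every eigenvalue is real and at least
  \<open>\<delta>\<close>.\<close>

lemma le_lambda_1:
  assumes A: "A \<in> carrier_mat n n" and n: "n > 0"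
    and herm: "hermitian_on n (\<lambda>k l. A $$ (k, l))"
    and low: "\<And>v. \<delta> * sq_norm_fun n v \<le> Re (sesq_form n (\<lambda>k l. A $$ (k, l)) v v)"
  shows "\<delta> \<le> lambda_1 A"
proof -
  have ev: "Im z = 0 \<and> \<delta> \<le> Re z" if "eigenvalue A z" for z
  proof -
    obtain x where x: "x \<in> carrier_vec n" "x \<noteq> 0\<^sub>v n" "A *\<^sub>v x = z \<cdot>\<^sub>v x"
      using \<open>eigenvalue A z\<close> A by (auto simp: eigenvalue_def eigenvector_def)
    define v where "v k = vec_index x k" for k
    have "(\<Sum>l<n. A $$ (k, l) * v l) = z * v k" if "k < n" for k
      using arg_cong[OF x(3), of "\<lambda>y. vec_index y k"] that A x(1)
      by (simp add: scalar_prod_def atLeast0LessThan v_def)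
    then have form: "sesq_form n (\<lambda>k l. A $$ (k, l)) v v = z * of_real (sq_norm_fun n v)"
      by (rule sesq_form_eigen)
    have "\<exists>k<n. v k \<noteq> 0"
      using x(1,2) unfolding v_def by (metis carrier_vecD eq_vecI index_zero_vec)
    then have N: "sq_norm_fun n v > 0"
      using sq_norm_fun_nonneg[of n v] sq_norm_fun_eq_0_iff[of n v] by auto
    have "cnj (z * of_real (sq_norm_fun n v)) = z * of_real (sq_norm_fun n v)"
      using sesq_form_cnj[OF herm, of v v] by (simp add: form)
    then have "Im z = 0" using N by (simp add: complex_eq_iff)
    moreover have "\<delta> \<le> Re z" using low[of v] N by (simp add: form)
    ultimately show ?thesis by simp
  qed
  \<comment> \<open>\<open>Min\<close> also calls for a nonempty set: a complex matrix of positive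
    size has an eigenvalue, and by \<open>ev\<close> it is real.\<close>
  obtain z where "eigenvalue A z"
    using spectrum_non_empty[OF A n] by (auto simp: spectrum_def)
  moreover from this have "z = of_real (Re z)"
    using ev by (intro complex_eqI) auto
  ultimately have "eigenvalue A (of_real (Re z))" by metis
  then show ?thesis
    unfolding lambda_1_def using ev[of "of_real x" for x] finite_real_eigenvalues[OF A]
    by (subst Min_ge_iff) auto
qed

subsection \<open>Spectral representation of the quadratic form\<close>

text \<open>\<open>\<kappa> a\<close> is the component to which the point \<open>y a\<close>
  belongs. Grouping the points by component turns the double sum over components into one over pairs
  of points, and the two phases of a pair combine.\<close>

lemma sesq_form_exponential_sums:
  fixes C :: "nat \<Rightarrow> nat \<Rightarrow> 'a::euclidean_space \<Rightarrow> complex" and y :: "'i \<Rightarrow> 'a"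
  assumes I: "finite I" and \<kappa>: "\<And>a. a \<in> I \<Longrightarrow> \<kappa> a < p"
  shows "sesq_form p (\<lambda>k l. C k l f) (\<lambda>k. \<Sum>a\<in>{a \<in> I. \<kappa> a = k}. v a * exp (- (\<i> * of_real (inner f (y a)))))
             (\<lambda>k. \<Sum>a\<in>{a \<in> I. \<kappa> a = k}. v a * exp (- (\<i> * of_real (inner f (y a)))))
     = (\<Sum>a\<in>I. \<Sum>b\<in>I. cnj (v a) * v b * (C (\<kappa> a) (\<kappa> b) f * exp (\<i> * of_real (inner f (y a - y b)))))"
proof -
  define w where "w a = v a * exp (- (\<i> * complex_of_real (inner f (y a))))" for a
  have group: "(\<Sum>k<p. \<Sum>a\<in>{a \<in> I. \<kappa> a = k}. h k a) = (\<Sum>a\<in>I. h (\<kappa> a) a)" for h :: "nat \<Rightarrow> 'i \<Rightarrow> complex"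
  proof -
    have "(\<Sum>k<p. \<Sum>a\<in>{a \<in> I. \<kappa> a = k}. h k a) = (\<Sum>k<p. \<Sum>a\<in>{a \<in> I. \<kappa> a = k}. h (\<kappa> a) a)"
      by (intro sum.cong) auto
    also have "\<dots> = (\<Sum>a\<in>I. h (\<kappa> a) a)"
      using I \<kappa> by (intro sum.group) auto
    finally show ?thesis .
  qed
  have phase: "cnj (w a) * w b = cnj (v a) * v b * exp (\<i> * of_real (inner f (y a - y b)))" for a b
    by (simp add: w_def exp_cnj inner_diff_right exp_diff exp_minus field_simps)
  have "sesq_form p (\<lambda>k l. C k l f) (\<lambda>k. \<Sum>a\<in>{a \<in> I. \<kappa> a = k}. w a) (\<lambda>k. \<Sum>a\<in>{a \<in> I. \<kappa> a = k}. w a)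
      = (\<Sum>k<p. \<Sum>a\<in>{a \<in> I. \<kappa> a = k}. cnj (w a) * (\<Sum>l<p. \<Sum>b\<in>{b \<in> I. \<kappa> b = l}. C k l f * w b))"
    unfolding sesq_form_def sum_distrib_right[symmetric] sum_distrib_left[symmetric] cnj_sum[symmetric]
    by (simp only: sum_distrib_left mult.assoc)
  also have "\<dots> = (\<Sum>a\<in>I. \<Sum>b\<in>I. C (\<kappa> a) (\<kappa> b) f * (cnj (w a) * w b))"
    unfolding group by (simp add: sum_distrib_left mult_ac)
  also have "\<dots> = (\<Sum>a\<in>I. \<Sum>b\<in>I. cnj (v a) * v b * (C (\<kappa> a) (\<kappa> b) f * exp (\<i> * of_real (inner f (y a - y b)))))"
    unfolding phase by (simp only: mult_ac)
  finally show ?thesis unfolding w_def .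
qed

text \<open>The form of \<open>C\<close> couples the components, but its lower bound
  \<open>low\<close> involves only the separate sums \<open>U f k\<close>. Hence
  \<open>exp_sum\<close> is applied within each component, and points of different components may
  coincide.\<close>

lemma quadratic_form_lower_bound:
  fixes C :: "nat \<Rightarrow> nat \<Rightarrow> 'a::euclidean_space \<Rightarrow> complex" and y :: "'i \<Rightarrow> 'a"
  assumes g: "\<And>k l h. k < p \<Longrightarrow> l < p \<Longrightarrow> g k l h = (LINT f|lborel. C k l f * exp (\<i> * of_real (inner f h)))"
    and C: "\<And>k l. k < p \<Longrightarrow> l < p \<Longrightarrow> integrable lborel (C k l)"
    and nonneg: "\<And>f u. 0 \<le> Re (sesq_form p (\<lambda>k l. C k l f) u u)"
    and low: "\<And>f u. f \<in> K \<Longrightarrow> \<epsilon> * sq_norm_fun p u \<le> Re (sesq_form p (\<lambda>k l. C k l f) u u)"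
    and "\<epsilon> \<ge> 0" and K: "compact K"
    and exp_sum: "\<And>J v. J \<subseteq> I \<Longrightarrow> separated_on D J y \<Longrightarrow> c * (\<Sum>j\<in>J. (cmod (v j))\<^sup>2)
         \<le> (LINT f|lborel. indicator K f * (cmod (\<Sum>j\<in>J. v j * exp (- (\<i> * of_real (inner f (y j))))))\<^sup>2)"
    and I: "finite I" and \<kappa>: "\<And>a. a \<in> I \<Longrightarrow> \<kappa> a < p"
    and sep: "\<And>k. k < p \<Longrightarrow> separated_on D {a \<in> I. \<kappa> a = k} y"
  shows "\<epsilon> * c * (\<Sum>a\<in>I. (cmod (v a))\<^sup>2)
      \<le> Re (\<Sum>a\<in>I. \<Sum>b\<in>I. cnj (v a) * v b * g (\<kappa> a) (\<kappa> b) (y a - y b))"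
proof -
  define U where "U f k = (\<Sum>a\<in>{a \<in> I. \<kappa> a = k}. v a * exp (- (\<i> * of_real (inner f (y a)))))" for f k
  define Q where "Q f = sesq_form p (\<lambda>k l. C k l f) (U f) (U f)" for f
  have Q: "Q f = (\<Sum>a\<in>I. \<Sum>b\<in>I. cnj (v a) * v b * (C (\<kappa> a) (\<kappa> b) f * exp (\<i> * of_real (inner f (y a - y b)))))" for f
    unfolding Q_def U_def by (rule sesq_form_exponential_sums[OF I \<kappa>])
  have int: "integrable lborel (\<lambda>f. C k l f * exp (\<i> * of_real (inner f h)))" if "k < p" "l < p" for k l h
    using C[OF that]
  proof (rule Bochner_Integration.integrable_bound)
    have "C k l \<in> borel_measurable borel" using C[OF that] by (simp add: integrable_iff_bounded)
    then show "(\<lambda>f. C k l f * exp (\<i> * of_real (inner f h))) \<in> borel_measurable lborel"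
      by (simp add: borel_measurable_times borel_measurable_continuous_onI continuous_intros)
  qed (simp add: norm_mult)
  have Q_int: "integrable lborel Q"
    unfolding Q[abs_def] by (intro Bochner_Integration.integrable_sum integrable_mult_right int \<kappa>)
  have "(LINT f|lborel. Q f) = (\<Sum>a\<in>I. \<Sum>b\<in>I. cnj (v a) * v b * g (\<kappa> a) (\<kappa> b) (y a - y b))"
    unfolding Q by (simp add: int \<kappa> g Bochner_Integration.integral_sum Bochner_Integration.integrable_sum)
  then have ReQ: "Re (\<Sum>a\<in>I. \<Sum>b\<in>I. cnj (v a) * v b * g (\<kappa> a) (\<kappa> b) (y a - y b)) = (LINT f|lborel. Re (Q f))"
    using Q_int by simp
  have U_int: "integrable lborel (\<lambda>f. indicator K f * (cmod (U f k))\<^sup>2)" for k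
  proof -
    have "continuous_on K (\<lambda>f. (cmod (U f k))\<^sup>2)"
      unfolding U_def by (intro continuous_intros)
    then show ?thesis
      using borel_integrable_compact[OF K, of "\<lambda>f. (cmod (U f k))\<^sup>2"] by simp
  qed
  have "\<epsilon> * c * (\<Sum>a\<in>I. (cmod (v a))\<^sup>2) = \<epsilon> * (\<Sum>k<p. c * (\<Sum>a\<in>{a \<in> I. \<kappa> a = k}. (cmod (v a))\<^sup>2))"
    using I \<kappa> by (subst sum.group[where g=\<kappa> and T="{..<p}", symmetric]) (auto simp: sum_distrib_left mult_ac)
  also have "\<dots> \<le> \<epsilon> * (\<Sum>k<p. LINT f|lborel. indicator K f * (cmod (U f k))\<^sup>2)"
    unfolding U_def using \<open>\<epsilon> \<ge> 0\<close> by (intro mult_left_mono sum_mono exp_sum sep) auto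
  also have "\<dots> = (LINT f|lborel. \<epsilon> * (\<Sum>k<p. indicator K f * (cmod (U f k))\<^sup>2))"
    by (simp only: integral_mult_right_zero Bochner_Integration.integral_sum[OF U_int])
  also have "\<dots> \<le> (LINT f|lborel. Re (Q f))"
  proof (rule integral_mono)
    show "\<epsilon> * (\<Sum>k<p. indicator K f * (cmod (U f k))\<^sup>2) \<le> Re (Q f)" for f
      using low[of f "U f"] nonneg[of f "U f"]
      by (cases "f \<in> K") (simp_all add: Q_def sq_norm_fun_def)
    show "integrable lborel (\<lambda>f. \<epsilon> * (\<Sum>k<p. indicator K f * (cmod (U f k))\<^sup>2))"
      by (intro integrable_mult_right Bochner_Integration.integrable_sum U_int)
    show "integrable lborel (\<lambda>f. Re (Q f))" using Q_int by simp
  qed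
  finally show ?thesis unfolding ReQ .
qed

text \<open>The integral of a non-integrable function is 0 by convention. The exponential has
  modulus 1, so if \<open>F\<close> were not integrable, all the integrals defining \<open>G\<close>
  would be 0, and then \<open>zero\<close> would force \<open>F\<close> to be the zero function,
  which is integrable.\<close>

lemma integrable_if_inversion:
  fixes F :: "'a::euclidean_space \<Rightarrow> complex"
  assumes F: "F \<in> borel_measurable borel"
    and G: "\<And>h. G h = (LINT f|lborel. F f * exp (\<i> * of_real (inner f h)))"
    and zero: "(\<And>h. G h = 0) \<Longrightarrow> F = (\<lambda>_. 0)"
  shows "integrable lborel F"
proof (rule ccontr)
  assume nint: "\<not> integrable lborel F"
  have "\<not> integrable lborel (\<lambda>f. F f * exp (\<i> * of_real (inner f h)))" for h
  proof
    assume "integrable lborel (\<lambda>f. F f * exp (\<i> * of_real (inner f h)))"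
    then have "integrable lborel F"
      by (rule Bochner_Integration.integrable_bound) (use F in \<open>simp_all add: norm_mult\<close>)
    with nint show False ..
  qed
  then have "G h = 0" for h by (simp add: G not_integrable_integral_eq)
  then have "F = (\<lambda>_. 0)" by (rule zero)
  with nint show False by simp
qed

section \<open>Measurability and symmetry of covariances and their transforms\<close>

lemma borel_measurable_inverse_fourier:
  fixes F :: "'a::euclidean_space \<Rightarrow> complex"
  assumes [measurable]: "F \<in> borel_measurable borel"
  shows "(\<lambda>h. LINT f|lborel. F f * exp (\<i> * of_real (inner f h))) \<in> borel_measurable borel"
  by (rule lborel.borel_measurable_lebesgue_integral) measurable

lemma lborel_distr_reflect: "distr lborel borel uminus = (lborel :: 'a::euclidean_space measure)"
  by (rule sym, rule trans[OF lborel_affine[of "-1" 0]]) (simp_all add: density_1)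

text \<open>As \<open>c\<close> is real, conjugation only reverses the sign of the exponent, and the
  substitution \<open>x \<mapsto> - x\<close> moves that sign to \<open>c\<close>.\<close>

lemma cnj_fourier:
  assumes "c \<in> borel_measurable borel"
  shows "cnj (fourier c f) = fourier (\<lambda>h. c (- h)) f"
proof -
  have m: "(\<lambda>x. complex_of_real (c x) * exp (\<i> * of_real (inner f x))) \<in> borel_measurable borel"
    using assms by (simp add: borel_measurable_times borel_measurable_continuous_onI continuous_intros)
  have "cnj (LINT x|lborel. of_real (c x) * exp (- \<i> * of_real (inner f x)))
      = (LINT x|lborel. cnj (of_real (c x) * exp (- \<i> * of_real (inner f x))))"
    by (simp only: Bochner_Integration.integral_cnj)
  also have "\<dots> = (LINT x|lborel. of_real (c x) * exp (\<i> * of_real (inner f x)))"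
    unfolding complex_cnj_mult exp_cnj by simp
  also have "\<dots> = (LINT x|distr lborel borel uminus. of_real (c x) * exp (\<i> * of_real (inner f x)))"
    by (simp only: lborel_distr_reflect)
  also have "\<dots> = (LINT x|lborel. of_real (c (- x)) * exp (- \<i> * of_real (inner f x)))"
    using m by (subst integral_distr) simp_all
  finally show ?thesis by (simp add: fourier_def)
qed

text \<open>Covariance is symmetric in its two variables; taking both orders at the sites 0 and
  \<open>h\<close> reverses the lag. Both the spectral and the covariance matrices are Hermitian for
  this reason.\<close>

lemma matrix_covariance_function_swap:
  assumes "matrix_covariance_function p M Z c" "k \<in> {1..p}" "l \<in> {1..p}"
  shows "c k l (- h) = c l k h"
proof -
  have "covariance M (Z k 0) (Z l h) = covariance M (Z l h) (Z k 0)"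
    by (simp add: covariance_def mult.commute)
  moreover have "covariance M (Z k 0) (Z l h) = c k l (0 - h)" "covariance M (Z l h) (Z k 0) = c l k (h - 0)"
    using assms unfolding matrix_covariance_function_def by blast+
  ultimately show ?thesis by simp
qed

text \<open>Minimality of \<open>block_of n a\<close> puts the end of the preceding block strictly
  before \<open>a\<close>, so the truncated subtraction in \<open>pos_of\<close> yields a position
  of at least 1.\<close>

lemma block_of_bounds:
  assumes "a \<ge> 1" "a \<le> block_end n p"
  shows "block_of n a \<in> {1..p}" and "block_end n (block_of n a - 1) < a"
proof -
  have le: "a \<le> block_end n (block_of n a)"
    unfolding block_of_def by (rule LeastI[of "\<lambda>k. a \<le> block_end n k"]) (rule assms(2))
  then have "block_of n a \<noteq> 0"
    using assms(1) by (intro notI) (simp add: block_end_def)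
  moreover have "block_of n a \<le> p"
    unfolding block_of_def by (rule Least_le) (rule assms(2))
  ultimately show "block_of n a \<in> {1..p}" by simp
  show "block_end n (block_of n a - 1) < a"
    using not_less_Least[of "block_of n a - 1" "\<lambda>k. a \<le> block_end n k"] \<open>block_of n a \<noteq> 0\<close>
    by (simp add: block_of_def[symmetric] not_le)
qed

section \<open>Lower bound uniform in the parameter and the sample sizes\<close>

theorem theorem5:
  fixes p :: nat
    and \<Theta> :: "(real ^ 'q) set"
    and M :: "real ^ 'q \<Rightarrow> 'a measure"
    and Z :: "real ^ 'q \<Rightarrow> nat \<Rightarrow> real ^ 'd \<Rightarrow> 'a \<Rightarrow> real"
    and c :: "real ^ 'q \<Rightarrow> nat \<Rightarrow> nat \<Rightarrow> real ^ 'd \<Rightarrow> real"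
    and x :: "nat \<Rightarrow> nat \<Rightarrow> real ^ 'd"
  assumes "p \<ge> 1"
    and "compact \<Theta>"
    and "\<And>\<theta>. \<theta> \<in> \<Theta> \<Longrightarrow> matrix_covariance_function p (M \<theta>) (Z \<theta>) (c \<theta>)"
    and "\<exists>A>0. \<exists>\<tau>>0. \<forall>\<theta>\<in>\<Theta>. \<forall>k\<in>{1..p}. \<forall>l\<in>{1..p}. \<forall>h.
           \<bar>c \<theta> k l h\<bar> \<le> A / (1 + infnorm h powr (real CARD('d) + \<tau>))"
    and "\<forall>\<theta>\<in>\<Theta>. \<forall>k\<in>{1..p}. \<forall>l\<in>{1..p}. \<forall>h.
           complex_of_real (c \<theta> k l h) =
             (LINT f|lborel. fourier (c \<theta> k l) f * exp (\<i> * of_real (inner f h)))"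
    and "\<forall>k\<in>{1..p}. \<forall>l\<in>{1..p}. continuous_on (UNIV \<times> \<Theta>) (\<lambda>(f, \<theta>). fourier (c \<theta> k l) f)"
    and "\<forall>f. \<forall>\<theta>\<in>\<Theta>. lambda_1 (spectral_matrix p (c \<theta>) f) > 0"
    and "\<exists>\<Delta>>0. \<forall>k\<in>{1..p}.
           (INF (i, j) \<in> {(i, j). i \<ge> 1 \<and> j \<ge> 1 \<and> i \<noteq> j}. infnorm (x k i - x k j)) \<ge> \<Delta>"
  shows "(INF (\<theta>, n) \<in> \<Theta> \<times> {n. \<forall>k\<in>{1..p}. n k \<ge> 1}.
           ereal (lambda_1 (map_mat of_real (covariance_matrix p (c \<theta>) x n)))) > 0"
proof -
  have p: "p \<ge> 1" by fact
  \<comment> \<open>Components are numbered from 1 and matrix indices from 0; \<open>C\<close> is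
    the spectral matrix in the latter numbering.\<close>
  define C where "C \<theta> k l f = fourier (c \<theta> (Suc k) (Suc l)) f" for \<theta> k l f
  have cov: "matrix_covariance_function p (M \<theta>) (Z \<theta>) (c \<theta>)" if "\<theta> \<in> \<Theta>" for \<theta>
    using that by (rule assms(3))
  have inv: "complex_of_real (c \<theta> (Suc k) (Suc l) h) = (LINT f|lborel. C \<theta> k l f * exp (\<i> * of_real (inner f h)))"
    if "\<theta> \<in> \<Theta>" "k < p" "l < p" for \<theta> k l h
    using assms(5) that by (simp add: C_def)
  have cont: "continuous_on (UNIV \<times> \<Theta>) (\<lambda>(f, \<theta>). C \<theta> k l f)" if "k < p" "l < p" for k l
    using assms(6) that by (simp add: C_def)
  have C_meas: "C \<theta> k l \<in> borel_measurable borel" if "\<theta> \<in> \<Theta>" "k < p" "l < p" for \<theta> k l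
  proof -
    have "continuous_on UNIV (\<lambda>f. (\<lambda>(f, \<theta>). C \<theta> k l f) (f, \<theta>))"
      using that by (intro continuous_on_compose2[OF cont[OF that(2,3)]] continuous_intros) auto
    then show ?thesis by (simp add: borel_measurable_continuous_onI)
  qed
  have C_int: "integrable lborel (C \<theta> k l)" if "\<theta> \<in> \<Theta>" "k < p" "l < p" for \<theta> k l
  proof (rule integrable_if_inversion[OF C_meas[OF that] inv[OF that]])
    assume "\<And>h. complex_of_real (c \<theta> (Suc k) (Suc l) h) = 0"
    then show "C \<theta> k l = (\<lambda>_. 0)" by (simp add: C_def[abs_def] fourier_def fun_eq_iff)
  qed
  have herm: "hermitian_on p (\<lambda>k l. C \<theta> k l f)" if \<theta>: "\<theta> \<in> \<Theta>" for \<theta> f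
    unfolding hermitian_on_def
  proof (intro allI impI)
    fix k l assume kl: "k < p" "l < p"
    \<comment> \<open>Inversion exhibits the covariance function as a parametric integral, so it is
      measurable, as the change of variable in \<open>cnj_fourier\<close> requires.\<close>
    have "(\<lambda>h. Re (LINT f|lborel. C \<theta> k l f * exp (\<i> * of_real (inner f h)))) \<in> borel_measurable borel"
      using measurable_compose[OF borel_measurable_inverse_fourier[OF C_meas[OF \<theta> kl]]
          borel_measurable_continuous_onI[OF continuous_on_Re[OF continuous_on_id]]] .
    then have "c \<theta> (Suc k) (Suc l) \<in> borel_measurable borel"
      by (simp flip: inv[OF \<theta> kl])
    then have "cnj (C \<theta> k l f) = fourier (\<lambda>h. c \<theta> (Suc k) (Suc l) (- h)) f"
      unfolding C_def by (rule cnj_fourier)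
    also have "(\<lambda>h. c \<theta> (Suc k) (Suc l) (- h)) = c \<theta> (Suc l) (Suc k)"
      using matrix_covariance_function_swap[OF cov[OF \<theta>]] kl by auto
    finally show "C \<theta> l k f = cnj (C \<theta> k l f)" by (simp add: C_def)
  qed
  have eigen_pos: "m > 0"
    if \<theta>: "\<theta> \<in> \<Theta>" and v: "sq_norm_fun p v \<noteq> 0"
      and eq: "\<And>k. k < p \<Longrightarrow> (\<Sum>l<p. C \<theta> k l f * v l) = of_real m * v k" for \<theta> f m v
  proof -
    have "lambda_1 (spectral_matrix p (c \<theta>) f) \<le> m"
    proof (rule lambda_1_le[OF _ v])
      show "spectral_matrix p (c \<theta>) f \<in> carrier_mat p p" by (simp add: spectral_matrix_def)
      show "(\<Sum>l<p. spectral_matrix p (c \<theta>) f $$ (k, l) * v l) = of_real m * v k" if "k < p" for k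
        using eq[OF that] that by (simp add: spectral_matrix_def C_def)
    qed
    with assms(7) \<theta> show ?thesis by (meson less_le_trans)
  qed
  have nonneg: "0 \<le> Re (sesq_form p (\<lambda>k l. C \<theta> k l f) u u)" if \<theta>: "\<theta> \<in> \<Theta>" for \<theta> f u
  proof -
    \<comment> \<open>A one-point parameter set gives positivity at the single frequency
      \<open>f\<close>; this covers the frequencies outside the box, where only nonnegativity is
      used.\<close>
    obtain \<epsilon> where "\<epsilon> > 0" "\<And>s v. s \<in> {f} \<Longrightarrow> \<epsilon> * sq_norm_fun p v \<le> Re (sesq_form p (\<lambda>k l. C \<theta> k l f) v v)"
    proof (rule hermitian_family_lower_bound[of "{f}" p "\<lambda>_ k l. C \<theta> k l f"])
      show "m > 0" if "sq_norm_fun p v \<noteq> 0"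
        "\<And>k. k < p \<Longrightarrow> (\<Sum>l<p. C \<theta> k l f * v l) = of_real m * v k" for m v
        using \<theta> that by (rule eigen_pos)
    qed (simp_all add: herm[OF \<theta>])
    then have "\<epsilon> > 0" "\<epsilon> * sq_norm_fun p u \<le> Re (sesq_form p (\<lambda>k l. C \<theta> k l f) u u)" by blast+
    moreover have "0 \<le> \<epsilon> * sq_norm_fun p u"
      using \<open>\<epsilon> > 0\<close> by (simp add: sq_norm_fun_nonneg)
    ultimately show ?thesis by linarith
  qed
  obtain \<Delta> where \<Delta>: "\<Delta> > 0"
    and \<Delta>_le: "\<forall>k\<in>{1..p}. (INF (i, j) \<in> {(i, j). i \<ge> 1 \<and> j \<ge> 1 \<and> i \<noteq> j}. infnorm (x k i - x k j)) \<ge> \<Delta>"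
    using assms(8) by blast
  have sep: "\<Delta> \<le> infnorm (x k i - x k j)" if "k \<in> {1..p}" "i \<ge> 1" "j \<ge> 1" "i \<noteq> j" for k i j
  proof -
    \<comment> \<open>The infimum of a set of reals lies below its members once the set is bounded
      below; here 0 is a bound.\<close>
    have "(INF (i, j) \<in> {(i, j). i \<ge> 1 \<and> j \<ge> 1 \<and> i \<noteq> j}. infnorm (x k i - x k j)) \<le> (\<lambda>(i, j). infnorm (x k i - x k j)) (i, j)"
      using that by (intro cINF_lower bdd_belowI[of _ 0]) (auto simp: infnorm_pos_le)
    with \<Delta>_le that(1) show ?thesis by force
  qed
  obtain K :: "(real ^ 'd) set" and \<kappa> where K: "compact K" and \<kappa>: "\<kappa> > 0"
    and exp_sum: "\<And>J (y :: nat \<Rightarrow> real ^ 'd) v. finite J \<Longrightarrow> separated_on \<Delta> J y \<Longrightarrow>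
       \<kappa> * (\<Sum>j\<in>J. (cmod (v j))\<^sup>2)
         \<le> (LINT f|lborel. indicator K f * (cmod (\<Sum>j\<in>J. v j * exp (- (\<i> * of_real (inner f (y j))))))\<^sup>2)"
    using exponential_sum_lower_bound[OF \<Delta>, where 'a="real ^ 'd" and 'i=nat] by blast
  \<comment> \<open>Compactness of \<open>K \<times> \<Theta>\<close> makes this constant
    independent of the frequency and the parameter.\<close>
  obtain \<epsilon> where \<epsilon>: "\<epsilon> > 0"
    and low: "\<And>s v. s \<in> K \<times> \<Theta> \<Longrightarrow> \<epsilon> * sq_norm_fun p v \<le> Re (sesq_form p (\<lambda>k l. C (snd s) k l (fst s)) v v)"
  proof (rule hermitian_family_lower_bound[of "K \<times> \<Theta>" p "\<lambda>s k l. C (snd s) k l (fst s)"])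
    show "compact (K \<times> \<Theta>)" using K assms(2) by (rule compact_Times)
    show "continuous_on (K \<times> \<Theta>) (\<lambda>s. C (snd s) k l (fst s))" if "k < p" "l < p" for k l
      using continuous_on_subset[OF cont[OF that], of "K \<times> \<Theta>"] by (simp add: case_prod_unfold Sigma_mono)
    show "hermitian_on p (\<lambda>k l. C (snd s) k l (fst s))" if "s \<in> K \<times> \<Theta>" for s
      using that by (intro herm) (simp add: mem_Times_iff)
    show "m > 0" if "s \<in> K \<times> \<Theta>" "sq_norm_fun p v \<noteq> 0"
      "\<And>k. k < p \<Longrightarrow> (\<Sum>l<p. C (snd s) k l (fst s) * v l) = of_real m * v k" for s m v
      using that by (intro eigen_pos[of "snd s" v "fst s" m]) (simp_all add: mem_Times_iff)
  qed (rule that; blast)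
  have bound: "\<epsilon> * \<kappa> \<le> lambda_1 (map_mat of_real (covariance_matrix p (c \<theta>) x n))"
    if \<theta>: "\<theta> \<in> \<Theta>" and n: "\<forall>k\<in>{1..p}. n k \<ge> 1" for \<theta> n
  proof -
    define N where "N = block_end n p"
    \<comment> \<open>Row \<open>a\<close> is row \<open>a + 1\<close> in the usual numbering;
      \<open>\<beta> a\<close> is its component counted from 0, and \<open>y a\<close> is its
      point.\<close>
    define \<beta> where "\<beta> a = block_of n (Suc a) - 1" for a
    define y where "y a = x (Suc (\<beta> a)) (pos_of n (Suc a))" for a
    define A :: "complex mat" where "A = map_mat of_real (covariance_matrix p (c \<theta>) x n)"
    have block: "block_of n (Suc a) = Suc (\<beta> a)" "\<beta> a < p" "block_end n (\<beta> a) \<le> a" if "a < N" for a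
      using block_of_bounds[of "Suc a" n p] that by (auto simp: \<beta>_def N_def)
    have A: "A \<in> carrier_mat N N" by (simp add: A_def N_def covariance_matrix_def)
    have entry: "A $$ (a, b) = of_real (c \<theta> (Suc (\<beta> a)) (Suc (\<beta> b)) (y a - y b))" if "a < N" "b < N" for a b
      using that by (simp add: A_def covariance_matrix_def N_def[symmetric] block y_def)
    have "n 1 \<le> N"
      unfolding N_def block_end_def using p by (intro member_le_sum) auto
    moreover have "1 \<le> n 1" using n p by simp
    ultimately have N: "N > 0" by linarith
    have "\<epsilon> * \<kappa> \<le> lambda_1 A"
    proof (rule le_lambda_1[OF A N])
      have swap: "c \<theta> (Suc (\<beta> b)) (Suc (\<beta> a)) (y b - y a) = c \<theta> (Suc (\<beta> a)) (Suc (\<beta> b)) (y a - y b)"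
        if "a < N" "b < N" for a b
        using matrix_covariance_function_swap[OF cov[OF \<theta>], of "Suc (\<beta> b)" "Suc (\<beta> a)" "y a - y b"]
          block(2)[OF that(1)] block(2)[OF that(2)] by simp
      show "hermitian_on N (\<lambda>a b. A $$ (a, b))"
        unfolding hermitian_on_def
      proof (intro allI impI)
        fix a b assume ab: "a < N" "b < N"
        show "A $$ (b, a) = cnj (A $$ (a, b))"
          unfolding entry[OF ab] entry[OF ab(2,1)] swap[OF ab] by simp
      qed
      fix v
      have "\<epsilon> * \<kappa> * (\<Sum>a<N. (cmod (v a))\<^sup>2)
        \<le> Re (\<Sum>a<N. \<Sum>b<N. cnj (v a) * v b * of_real (c \<theta> (Suc (\<beta> a)) (Suc (\<beta> b)) (y a - y b)))"
      proof (rule quadratic_form_lower_bound[OF inv[OF \<theta>] C_int[OF \<theta>] nonneg[OF \<theta>] _ _ K])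
        show "\<epsilon> * sq_norm_fun p u \<le> Re (sesq_form p (\<lambda>k l. C \<theta> k l f) u u)" if "f \<in> K" for f u
          using low[of "(f, \<theta>)" u] that \<theta> by simp
        show "\<kappa> * (\<Sum>j\<in>J. (cmod (w j))\<^sup>2)
         \<le> (LINT f|lborel. indicator K f * (cmod (\<Sum>j\<in>J. w j * exp (- (\<i> * of_real (inner f (y j))))))\<^sup>2)"
          if "J \<subseteq> {..<N}" "separated_on \<Delta> J y" for J w
          using that finite_subset by (intro exp_sum) auto
        show "separated_on \<Delta> {a \<in> {..<N}. \<beta> a = k} y" if "k < p" for k
          unfolding separated_on_def
        proof (intro ballI impI)
          fix a b assume "a \<in> {a \<in> {..<N}. \<beta> a = k}" "b \<in> {a \<in> {..<N}. \<beta> a = k}" and ab: "a \<noteq> b"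
          then have ab': "a < N" "b < N" "\<beta> a = k" "\<beta> b = k" by auto
          \<comment> \<open>Rows of one component share the offset \<open>block_end n k\<close>,
            which exceeds neither \<open>a\<close> nor \<open>b\<close>, so the subtraction is not
            truncated and distinct rows have distinct positions of at least 1.\<close>
          have "pos_of n (Suc a) = Suc a - block_end n k" "block_end n k \<le> a"
            "pos_of n (Suc b) = Suc b - block_end n k" "block_end n k \<le> b"
            using block[of a] block[of b] ab' by (simp_all add: pos_of_def)
          then show "\<Delta> \<le> infnorm (y a - y b)"
            unfolding y_def ab' using \<open>k < p\<close> ab by (intro sep) auto
        qed
      qed (use \<epsilon> block(2) in auto)
      moreover have "sesq_form N (\<lambda>a b. A $$ (a, b)) v v
          = (\<Sum>a<N. \<Sum>b<N. cnj (v a) * v b * of_real (c \<theta> (Suc (\<beta> a)) (Suc (\<beta> b)) (y a - y b)))"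
        unfolding sesq_form_def by (intro sum.cong refl) (simp add: entry)
      ultimately show "\<epsilon> * \<kappa> * sq_norm_fun N v \<le> Re (sesq_form N (\<lambda>a b. A $$ (a, b)) v v)"
        unfolding sq_norm_fun_def by simp
    qed
    then show ?thesis unfolding A_def .
  qed
  have "0 < ereal (\<epsilon> * \<kappa>)" using \<epsilon> \<kappa> by simp
  \<comment> \<open>In \<open>ereal\<close> the infimum over an empty \<open>\<Theta>\<close> is
    infinite, so a common lower bound suffices in every case.\<close>
  also have "\<dots> \<le> (INF (\<theta>, n) \<in> \<Theta> \<times> {n. \<forall>k\<in>{1..p}. n k \<ge> 1}.
           ereal (lambda_1 (map_mat of_real (covariance_matrix p (c \<theta>) x n))))"
    by (rule INF_greatest) (auto simp del: One_nat_def intro: bound)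
  finally show ?thesis .
qed

end
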